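(* Let $G$ and $H$ be connected graphs, each with more than one vertex, of orders $n$ and $m$ respectively. Suppose $G$ is just a frame graph in the spaces of dimension $n',n'+1,\dots,n-1,n$ and $H$ is just a frame graph in the spaces of dimension $m',m'+1,\dots,m-1,m$, where $n'\ge m'$. Then: (i) the join $G\vee H$ is just a frame graph in the spaces of dimension $n',n'+1,\dots,m+n-1,m+n$; (ii) $G.H$, the graph obtained by joining $G$ and $H$ at a single common vertex, is just a frame graph in the spaces of dimension $n'+m',n'+m'+1,\dots,m+n-2,m+n-1$.
   Context: All graphs are finite and simple. A finite frame for a finite-dimensional inner product space $\mathcal{H}$ over $\mathbb{R}$ or $\mathbb{C}$ is a finite sequence $\varphi=(f_i)_{i=1}^N$ in $\mathcal{H}$ for which there are constants $0<A\le B<\infty$ with $A\|f\|^2\le\sum_{i=1}^N|\langle f,f_i\rangle|^2\le B\|f\|^2$ for all $f\in\mathcal{H}$ (equivalently, a finite sequence spanning $\mathcal{H}$; repeated vectors are allowed and count as different vertices). Its frame graph $G(\varphi)$ has the elements $f_1,\dots,f_N$ of the sequence as vertices, and for $i\ne j$, $f_i$ and $f_j$ are adjacent iff $\langle f_i,f_j\rangle\ne 0$. A graph $G$ is a frame graph in $\mathcal{H}$ if there is a finite frame $\varphi$ for $\mathcal{H}$ with $G(\varphi)=G$ (up to labelling of vertices). "$G$ is just a frame graph in the spaces of dimension $a,a+1,\dots,b$" means: for each $\mathbb{F}\in\{\mathbb{R},\mathbb{C}\}$ and each integer $d\ge1$, $G$ is a frame graph in a $d$-dimensional inner product space over $\mathbb{F}$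 if and only if $a\le d\le b$. The join $G_1\vee G_2$ of vertex-disjoint graphs $G_1=(V_1,E_1)$, $G_2=(V_2,E_2)$ has vertex set $V_1\cup V_2$ and edge set $E_1\cup E_2$ together with all edges joining a vertex of $V_1$ to a vertex of $V_2$. The graph $G_1.G_2$ is a graph that is the union of (copies of) $G_1$ and $G_2$ sharing exactly one vertex $v$, with no edges between a vertex of $V_1\setminus\{v\}$ and a vertex of $V_2\setminus\{v\}$; the choice of the vertex of $G_1$ and the vertex of $G_2$ that are identified is arbitrary. *)

theory Defs
  imports "Jordan_Normal_Form.Matrix" "Graph_Theory.Graph_Theory"
begin

text \<open>
  Finite simple graphs are \<^locale>\<open>pair_graph\<close>s: finite, loop-free and symmetric, with each edge
  stored as two opposite pairs.
\<close>

definition graph_join ::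
  "'a pair_pre_digraph \<Rightarrow> 'b pair_pre_digraph \<Rightarrow> ('a + 'b) pair_pre_digraph" where
  "graph_join G H =
    \<lparr> pverts = Inl ` pverts G \<union> Inr ` pverts H,
      parcs = map_prod Inl Inl ` parcs G \<union> map_prod Inr Inr ` parcs H
        \<union> (Inl ` pverts G) \<times> (Inr ` pverts H) \<union> (Inr ` pverts H) \<times> (Inl ` pverts G) \<rparr>"

text \<open>
  In the disjoint union of \<open>G\<close> and \<open>H\<close>, the vertex \<open>w\<close> of \<open>H\<close> is identified with the vertex \<open>u\<close>
  of \<open>G\<close>; the common vertex is represented by \<open>Inl u\<close>.
\<close>

definition graph_glue ::
  "'a pair_pre_digraph \<Rightarrow> 'a \<Rightarrow> 'b pair_pre_digraph \<Rightarrow> 'b \<Rightarrow> ('a + 'b) pair_pre_digraph" where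
  "graph_glue G u H w =
    (let g = (\<lambda>y. if y = w then Inl u else Inr y) in
    \<lparr> pverts = Inl ` pverts G \<union> g ` pverts H,
      parcs = map_prod Inl Inl ` parcs G \<union> map_prod g g ` parcs H \<rparr>)"

text \<open>
  The field \<open>'f\<close> is meant to be \<^typ>\<open>real\<close> or \<^typ>\<open>complex\<close>, where \<^const>\<open>conjugate\<close> is the
  identity and complex conjugation, respectively. Up to the choice of a basis, every
  \<open>d\<close>-dimensional inner product space over \<open>'f\<close> is \<open>carrier_vec d\<close> with an arbitrary inner
  product, not necessarily the standard one; the inner product is linear in the first argument.
  Only its values on \<open>carrier_vec d\<close> matter.
\<close>

locale vec_inner_product =
  fixes d :: nat
    and ip :: "'f::{conjugatable_field, real_normed_field} vec \<Rightarrow> 'f vec \<Rightarrow> 'f"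
  assumes ip_add: "\<lbrakk>x \<in> carrier_vec d; y \<in> carrier_vec d; z \<in> carrier_vec d\<rbrakk>
      \<Longrightarrow> ip (x + y) z = ip x z + ip y z"
    and ip_smult: "\<lbrakk>x \<in> carrier_vec d; y \<in> carrier_vec d\<rbrakk> \<Longrightarrow> ip (a \<cdot>\<^sub>v x) y = a * ip x y"
    and ip_conjugate: "\<lbrakk>x \<in> carrier_vec d; y \<in> carrier_vec d\<rbrakk> \<Longrightarrow> ip y x = conjugate (ip x y)"
    and ip_pos: "\<lbrakk>x \<in> carrier_vec d; x \<noteq> 0\<^sub>v d\<rbrakk> \<Longrightarrow> \<exists>r::real. r > 0 \<and> ip x x = of_real r"

text \<open>
  On \<open>carrier_vec d\<close> the scalar \<open>ip x x\<close> is a nonnegative real; the inner \<open>norm\<close> (absolute value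
  of scalars) only turns it into an element of type \<^typ>\<open>real\<close>.
\<close>

definition ip_norm ::
  "('f::{conjugatable_field, real_normed_field} vec \<Rightarrow> 'f vec \<Rightarrow> 'f) \<Rightarrow> 'f vec \<Rightarrow> real" where
  "ip_norm ip x = sqrt (norm (ip x x))"

definition finite_frame ::
  "nat \<Rightarrow> ('f::{conjugatable_field, real_normed_field} vec \<Rightarrow> 'f vec \<Rightarrow> 'f) \<Rightarrow> 'f vec list \<Rightarrow> bool" where
  "finite_frame d ip \<phi> \<longleftrightarrow>
    set \<phi> \<subseteq> carrier_vec d \<and>
    (\<exists>A B. 0 < A \<and> A \<le> B \<and>
      (\<forall>f \<in> carrier_vec d.
        A * (ip_norm ip f)\<^sup>2 \<le> (\<Sum>i<length \<phi>. (norm (ip f (\<phi> ! i)))\<^sup>2) \<and>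
        (\<Sum>i<length \<phi>. (norm (ip f (\<phi> ! i)))\<^sup>2) \<le> B * (ip_norm ip f)\<^sup>2))"

text \<open>The vertices are the indices, so that repeated vectors give different vertices.\<close>

definition frame_graph ::
  "('f::{conjugatable_field, real_normed_field} vec \<Rightarrow> 'f vec \<Rightarrow> 'f) \<Rightarrow> 'f vec list
    \<Rightarrow> nat pair_pre_digraph" where
  "frame_graph ip \<phi> =
    \<lparr> pverts = {..<length \<phi>},
      parcs = {(i, j). i < length \<phi> \<and> j < length \<phi> \<and> i \<noteq> j \<and> ip (\<phi> ! i) (\<phi> ! j) \<noteq> 0} \<rparr>"

definition is_frame_graph ::
  "'f::{conjugatable_field, real_normed_field} itself \<Rightarrow> nat \<Rightarrow> 'a pair_pre_digraph \<Rightarrow> bool" where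
  "is_frame_graph _ d G \<longleftrightarrow>
    (\<exists>(ip :: 'f vec \<Rightarrow> 'f vec \<Rightarrow> 'f) \<phi>.
      vec_inner_product d ip \<and> finite_frame d ip \<phi> \<and>
      digraph_iso (with_proj (frame_graph ip \<phi>)) (with_proj G))"

definition just_frame_graph :: "'a pair_pre_digraph \<Rightarrow> nat \<Rightarrow> nat \<Rightarrow> bool" where
  "just_frame_graph G a b \<longleftrightarrow>
    (\<forall>d\<ge>1. is_frame_graph TYPE(real) d G \<longleftrightarrow> a \<le> d \<and> d \<le> b) \<and>
    (\<forall>d\<ge>1. is_frame_graph TYPE(complex) d G \<longleftrightarrow> a \<le> d \<and> d \<le> b)"

end

theory Submission
  imports Defs "HOL-Library.Function_Algebras" "HOL-Analysis.L2_Norm"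
    "HOL-Computational_Algebra.Polynomial"
begin

text \<open>
  A graph is a frame graph in dimension \<open>d\<close> iff it is the non-orthogonality graph of vectors in
  some finite-dimensional standard inner product space whose span has dimension \<open>d\<close>. If \<open>d\<close> is less
  than the number of vertices, some vector lies in the span of the others, and adding to it a new
  coordinate gives dimension \<open>d + 1\<close>; so only the minimal dimension matters.

  For the join, restricting to \<open>G\<close> shows that at least \<open>n'\<close> dimensions are needed. They suffice:
  put both families into the same space of dimension \<open>n'\<close>, and move the vectors of \<open>H\<close> by
  a reflection such that none of them is orthogonal to a vector of \<open>G\<close>.

  For \<open>G.H\<close>, the vectors of \<open>G - v\<close> and of \<open>H - v\<close> span orthogonal subspaces. Projecting the common
  vector to either of them gives representations of \<open>G\<close> and of \<open>H\<close>, so the dimension is at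
  least \<open>n' + m'\<close>. The orthogonal sum, with the sum of the two identified vectors as the common
  vector, lives in a space of dimension \<open>n' + m'\<close>.
\<close>

subsection \<open>Scalars, function spaces and positive forms\<close>

text \<open>Treats real and complex scalars at once. The axiom links conjugation to the norm; from
  it follow that conjugation preserves the norm and fixes the reals.\<close>

class rc_field = conjugatable_field + real_normed_field +
  assumes mult_conjugate_scaleR: "x * conjugate x = (norm x)\<^sup>2 *\<^sub>R 1"

instance real :: rc_field
  by standard (simp add: power2_eq_square)

instance complex :: rc_field
  by standard (simp add: complex_norm_square[symmetric] scaleR_conv_of_real)

lemma mult_conjugate_self: "x * conjugate x = of_real ((norm (x::'f::rc_field))\<^sup>2)"
  by (simp add: mult_conjugate_scaleR of_real_def)

lemma norm_conjugate [simp]: "norm (conjugate x) = norm (x::'f::rc_field)"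
proof (cases "x = 0")
  case False
  have "norm x * norm (conjugate x) = norm x * norm x"
    using arg_cong[OF mult_conjugate_self[of x], of norm] by (simp add: norm_mult power2_eq_square)
  then show ?thesis using False by simp
qed simp

lemma conjugate_of_real [simp]: "conjugate (of_real r) = (of_real r :: 'f::rc_field)"
proof (cases "r = 0")
  case False
  have "of_real r * conjugate (of_real r :: 'f) = of_real r * of_real r"
    using mult_conjugate_self[of "of_real r :: 'f"] by (simp add: power2_eq_square)
  then show ?thesis using False by simp
qed simp

lemma conjugate_numeral [simp]: "conjugate (numeral k) = (numeral k :: 'f::rc_field)"
  using conjugate_of_real[of "numeral k", where 'f='f] by (simp del: conjugate_of_real)

lemma conjugate_one [simp]: "conjugate 1 = (1 :: 'f::rc_field)"
  using conjugate_of_real[of 1, where 'f='f] by (simp del: conjugate_of_real)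

lemma conjugate_divide [simp]: "conjugate (x / y) = conjugate x / conjugate (y :: 'f::rc_field)"
proof (cases "y = 0")
  case False
  have "conjugate (x / y) * conjugate y = conjugate x"
    using False by (simp flip: conjugate_dist_mul)
  then show ?thesis using False by (simp add: eq_divide_eq)
qed simp

section \<open>Function spaces over a field\<close>

definition fscale :: "'f::field \<Rightarrow> ('i \<Rightarrow> 'f) \<Rightarrow> 'i \<Rightarrow> 'f" where
  "fscale c x = (\<lambda>i. c * x i)"

lemma fscale_apply: "fscale c x i = c * x i"
  by (simp add: fscale_def)

interpretation fs: vector_space fscale
  by unfold_locales (auto simp: fun_eq_iff fscale_apply algebra_simps)

lemma sum_fun_apply: "(\<Sum>a\<in>A. f a) i = (\<Sum>a\<in>A. f a i)"
  by (induction A rule: infinite_finite_induct) (auto simp: zero_fun_apply plus_fun_apply)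

lemmas fun_apply = plus_fun_apply zero_fun_apply minus_apply uminus_apply fscale_apply sum_fun_apply

(* Goals produced by the induction method are eta-expanded, and these rules would then rewrite
   functions that are not applied to an argument. *)
declare plus_fun_apply [simp del] zero_fun_apply [simp del] minus_apply [simp del] uminus_apply [simp del]

text \<open>For finite \<open>I\<close> this is the coordinate space of dimension
  \<open>card I\<close>. Keeping all these spaces inside one function type turns embeddings between
  different dimensions into inclusions.\<close>

definition supported :: "'i set \<Rightarrow> ('i \<Rightarrow> 'f::field) set" where
  "supported I = {x. \<forall>i. i \<notin> I \<longrightarrow> x i = 0}"

lemma subspace_supported: "fs.subspace (supported I)"
  by (auto simp: fs.subspace_def fun_apply supported_def)

lemma supported_mono: "I \<subseteq> J \<Longrightarrow> supported I \<subseteq> supported J"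
  by (auto simp: supported_def)

definition unit_fun :: "'i \<Rightarrow> 'i \<Rightarrow> 'f::field" where
  "unit_fun i = (\<lambda>j. if j = i then 1 else 0)"

lemma supported_expand:
  assumes "finite I" "x \<in> supported I"
  shows "x = (\<Sum>i\<in>I. fscale (x i) (unit_fun i))"
proof
  fix j show "x j = (\<Sum>i\<in>I. fscale (x i) (unit_fun i)) j"
    using assms by (cases "j \<in> I") (simp_all add: fun_apply unit_fun_def supported_def if_distrib cong: if_cong)
qed

lemma span_unit_fun:
  assumes "finite I"
  shows "fs.span (unit_fun ` I) = (supported I :: ('i \<Rightarrow> 'f::field) set)"
proof
  show "fs.span (unit_fun ` I) \<subseteq> (supported I :: ('i \<Rightarrow> 'f) set)"
    by (rule fs.span_minimal[OF _ subspace_supported]) (auto simp: supported_def unit_fun_def)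
  show "(supported I :: ('i \<Rightarrow> 'f) set) \<subseteq> fs.span (unit_fun ` I)"
  proof
    fix x :: "'i \<Rightarrow> 'f" assume "x \<in> supported I"
    then have "x = (\<Sum>i\<in>I. fscale (x i) (unit_fun i))"
      by (rule supported_expand[OF assms])
    moreover have "(\<Sum>i\<in>I. fscale (x i) (unit_fun i)) \<in> fs.span (unit_fun ` I)"
      by (intro fs.span_sum fs.span_scale fs.span_base) simp
    ultimately show "x \<in> fs.span (unit_fun ` I)" by simp
  qed
qed

section \<open>Dimension of spans of finite sets\<close>

lemma dim_supported_le:
  assumes "finite I" "S \<subseteq> supported I"
  shows "fs.dim S \<le> card I"
proof -
  have "fs.dim S \<le> card (unit_fun ` I :: ('a \<Rightarrow> 'b) set)"
    using assms span_unit_fun[OF assms(1)] by (intro fs.dim_le_card) auto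
  then show ?thesis using card_image_le[OF assms(1)] le_trans by blast
qed

text \<open>The ambient function space may be infinite-dimensional, so here and below a finite
  spanning set supplies the finiteness.\<close>

lemma basis_of_finite:
  fixes S :: "('i \<Rightarrow> 'f::field) set"
  assumes "finite S"
  obtains B where "B \<subseteq> S" "finite B" "fs.independent B" "fs.span B = fs.span S" "card B = fs.dim S"
proof -
  obtain B where B: "B \<subseteq> S" "fs.independent B" "S \<subseteq> fs.span B" "card B = fs.dim S"
    by (rule fs.basis_exists)
  then have "fs.span B = fs.span S"
    by (metis fs.span_mono fs.span_span subset_antisym)
  with B assms that show ?thesis by (meson finite_subset)
qed

lemma dim_mono_finite:
  fixes S T :: "('i \<Rightarrow> 'f::field) set"
  assumes "finite T" "S \<subseteq> fs.span T"
  shows "fs.dim S \<le> fs.dim T"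
proof -
  obtain B where "B \<subseteq> T" "finite B" "fs.independent B" "fs.span B = fs.span T" "card B = fs.dim T"
    by (rule basis_of_finite[OF assms(1)])
  then show ?thesis using fs.dim_le_card[of S B] assms(2) by simp
qed

lemma independent_card_le_dim_finite:
  fixes S T :: "('i \<Rightarrow> 'f::field) set"
  assumes "finite T" "S \<subseteq> fs.span T" "fs.independent S"
  shows "finite S" "card S \<le> fs.dim T"
proof -
  obtain B where "B \<subseteq> T" "finite B" "fs.independent B" "fs.span B = fs.span T" "card B = fs.dim T"
    by (rule basis_of_finite[OF assms(1)])
  then show "finite S" "card S \<le> fs.dim T"
    using fs.independent_span_bound[of B S] assms by simp_all
qed

lemma dim_insert_finite:
  fixes S :: "('i \<Rightarrow> 'f::field) set"
  assumes "finite S" "x \<notin> fs.span S"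
  shows "fs.dim (insert x S) = Suc (fs.dim S)"
proof -
  obtain B where B: "B \<subseteq> S" "finite B" "fs.independent B" "fs.span B = fs.span S" "card B = fs.dim S"
    by (rule basis_of_finite[OF assms(1)])
  have "fs.independent (insert x B)"
    using B assms by (intro fs.independent_insertI) auto
  moreover have "insert x S \<subseteq> fs.span (insert x B)"
    using B(4) fs.span_superset[of S] fs.span_mono[of B "insert x B"] fs.span_base[of x "insert x B"] by auto
  ultimately have "fs.dim (insert x S) = card (insert x B)"
    using B by (intro fs.basis_card_eq_dim[symmetric]) auto
  moreover have "x \<notin> B" using assms B fs.span_base by metis
  ultimately show ?thesis using B by simp
qed

text \<open>A basis of \<open>fs.span S\<close> and one of \<open>fs.span T\<close> are disjoint and
  together independent, and they lie in the span of \<open>U\<close>.\<close>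

lemma dim_trivial_Int:
  fixes S T U :: "('i \<Rightarrow> 'f::field) set"
  assumes fin: "finite S" "finite T" "finite U" and "S \<subseteq> fs.span U" "T \<subseteq> fs.span U"
    and triv: "fs.span S \<inter> fs.span T \<subseteq> {0}"
  shows "fs.dim S + fs.dim T \<le> fs.dim U"
proof -
  obtain B where B: "B \<subseteq> S" "finite B" "fs.independent B" "fs.span B = fs.span S" "card B = fs.dim S"
    by (rule basis_of_finite[OF fin(1)])
  obtain C where C: "C \<subseteq> T" "finite C" "fs.independent C" "fs.span C = fs.span T" "card C = fs.dim T"
    by (rule basis_of_finite[OF fin(2)])
  \<comment> \<open>The vectors of \<open>C\<close> are added to \<open>B\<close> one at a
    time.\<close>
  have "D \<subseteq> C \<Longrightarrow> fs.independent (D \<union> B) \<and> D \<inter> B = {}" if "finite D" for D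
    using that
  proof (induction D)
    case empty then show ?case using B by simp
  next
    case (insert c D)
    have "c \<notin> fs.span (D \<union> B)"
    proof
      assume "c \<in> fs.span (D \<union> B)"
      then obtain y z where yz: "y \<in> fs.span D" "z \<in> fs.span B" "c = y + z"
        unfolding fs.span_Un by blast
      have "y \<in> fs.span C" "c \<in> fs.span C"
        using yz(1) insert.prems fs.span_mono[of D C] fs.span_base[of c C] by auto
      \<comment> \<open>The difference \<open>c - y\<close> equals \<open>z\<close>, so it lies in
        both spans and vanishes; then \<open>c\<close> depends on the other vectors of
        \<open>C\<close>.\<close>
      then have "c - y \<in> fs.span C" using fs.span_diff by blast
      then have "c - y \<in> fs.span S \<inter> fs.span T" using yz B C by simp
      then have "c = y" using triv by auto
      then have "c \<in> fs.span (C - {c})"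
        using yz(1) insert fs.span_mono[of D "C - {c}"] by auto
      then show False using C(3) insert.prems fs.dependent_def by blast
    qed
    then show ?case
      using insert fs.independent_insertI[of c "D \<union> B"] fs.span_base[of c "D \<union> B"] by auto
  qed
  from this[OF C(2)] have "fs.independent (C \<union> B)" "C \<inter> B = {}" by auto
  moreover have "C \<union> B \<subseteq> fs.span U" using B(1) C(1) assms by blast
  ultimately have "card (C \<union> B) \<le> fs.dim U"
    using independent_card_le_dim_finite fin by blast
  then show ?thesis using B C \<open>C \<inter> B = {}\<close> by (simp add: card_Un_disjoint)
qed

section \<open>Hermitian forms, projections and Gram-Schmidt\<close>

text \<open>The algebraic laws hold for all functions, which avoids side conditions. Positivity is
  confined to \<open>supported J\<close>, because a form that reads only the coordinates in
  \<open>J\<close> vanishes on functions living outside \<open>J\<close>.\<close>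

locale pos_form =
  fixes J :: "'i set" and ip :: "('i \<Rightarrow> 'f::rc_field) \<Rightarrow> ('i \<Rightarrow> 'f) \<Rightarrow> 'f"
  assumes add_left: "ip (x + y) z = ip x z + ip y z"
    and scale_left: "ip (fscale a x) z = a * ip x z"
    and conj: "ip y x = conjugate (ip x y)"
    and pos: "x \<in> supported J \<Longrightarrow> x \<noteq> 0 \<Longrightarrow> \<exists>r::real. r > 0 \<and> ip x x = of_real r"
begin

lemma add_right: "ip z (x + y) = ip z x + ip z y"
  by (metis add_left conj conjugate_dist_add)

lemma scale_right: "ip z (fscale a x) = conjugate a * ip z x"
  by (metis conj conjugate_dist_mul scale_left)

lemma zero_left [simp]: "ip 0 z = 0"
  using add_left[of 0 0 z] by simp

lemma zero_right [simp]: "ip z 0 = 0"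
  using conj[of z 0] by simp

lemma diff_left: "ip (x - y) z = ip x z - ip y z"
  using add_left[of "x - y" y z] by (simp add: algebra_simps)

lemma diff_right: "ip z (x - y) = ip z x - ip z y"
  using add_right[of z "x - y" y] by (simp add: algebra_simps)

lemma sum_left: "ip (\<Sum>a\<in>A. f a) z = (\<Sum>a\<in>A. ip (f a) z)"
  by (induction A rule: infinite_finite_induct) (auto simp: add_left)

lemma sum_right: "ip z (\<Sum>a\<in>A. f a) = (\<Sum>a\<in>A. ip z (f a))"
  by (induction A rule: infinite_finite_induct) (auto simp: add_right)

lemma zero_commute: "ip x y = 0 \<longleftrightarrow> ip y x = 0"
  by (metis conj conjugate_zero_iff)

lemma eq_0: "x \<in> supported J \<Longrightarrow> ip x x = 0 \<Longrightarrow> x = 0"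
  using pos by fastforce

lemma orthogonal_span:
  assumes "\<And>s. s \<in> S \<Longrightarrow> ip x s = 0" "y \<in> fs.span S"
  shows "ip x y = 0"
  using assms(2)
  by (induction rule: fs.span_induct_alt) (auto simp: add_right scale_right assms(1))

text \<open>A vector in both spans is orthogonal to itself.\<close>

lemma orthogonal_spans_trivial_Int:
  assumes "\<And>s t. s \<in> S \<Longrightarrow> t \<in> T \<Longrightarrow> ip s t = 0" "S \<subseteq> supported J"
  shows "fs.span S \<inter> fs.span T \<subseteq> {0}"
proof
  fix x assume x: "x \<in> fs.span S \<inter> fs.span T"
  have "ip s x = 0" if "s \<in> S" for s
    using orthogonal_span[of T s x] assms that x by blast
  then have "ip x x = 0"
    using orthogonal_span[of S x x] x zero_commute by blast
  moreover have "x \<in> supported J"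
    using x fs.span_minimal[OF assms(2) subspace_supported] by blast
  ultimately show "x \<in> {0}" using eq_0 by blast
qed

text \<open>Induction on \<open>S\<close>: subtracting from the new vector its projection onto the
  old span leaves a direction \<open>?r\<close> orthogonal to that span, and the old projection of
  \<open>x\<close> is corrected by the component along \<open>?r\<close>.\<close>

lemma projection:
  assumes "finite S" "S \<subseteq> supported J"
  shows "\<exists>p \<in> fs.span S. \<forall>s\<in>fs.span S. ip (x - p) s = 0"
proof -
  \<comment> \<open>General in \<open>x\<close>, since the induction hypothesis is applied both to
    \<open>x\<close> and to the new vector \<open>s\<close>.\<close>
  have "\<exists>p \<in> fs.span S. \<forall>s\<in>S. ip (x - p) s = 0" for x
    using assms
  proof (induction S arbitrary: x)
    case empty then show ?case by simp
  next
    case (insert s S)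
    obtain q where q: "q \<in> fs.span S" "\<forall>t\<in>S. ip (s - q) t = 0"
      using insert.IH[of s] insert.prems by auto
    obtain p where p: "p \<in> fs.span S" "\<forall>t\<in>S. ip (x - p) t = 0"
      using insert.IH[of x] insert.prems by auto
    let ?r = "s - q"
    have q': "q \<in> supported J"
      using q(1) insert.prems fs.span_minimal[OF _ subspace_supported] by (meson insert_subset subsetD)
    then have r: "?r \<in> supported J"
      using insert.prems fs.subspace_diff[OF subspace_supported] by blast
    \<comment> \<open>If \<open>?r\<close> is zero, the quotient is zero by convention and
      \<open>p\<close> stays as it is.\<close>
    let ?c = "ip (x - p) ?r / ip ?r ?r"
    define p' where "p' = p + fscale ?c ?r"
    have "x - p' = (x - p) - fscale ?c ?r" by (simp add: p'_def)
    then have expand: "ip (x - p') y = ip (x - p) y - ?c * ip ?r y" for y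
      by (simp only: diff_left scale_left)
    have orthS: "\<forall>t\<in>S. ip (x - p') t = 0"
      using p(2) q(2) by (simp add: expand)
    have "ip (x - p') ?r = 0"
      using eq_0[OF r] by (cases "?r = 0") (auto simp: expand)
    moreover have "ip (x - p') q = 0"
      using orthogonal_span orthS q(1) by blast
    ultimately have "ip (x - p') s = 0"
      using diff_right[of "x - p'" s q] by simp
    then have orth: "\<forall>t\<in>insert s S. ip (x - p') t = 0"
      using orthS by simp
    have "fs.span S \<subseteq> fs.span (insert s S)"
      by (rule fs.span_mono) blast
    then have "p' \<in> fs.span (insert s S)"
      unfolding p'_def using p(1) q(1)
      by (intro fs.span_add fs.span_scale fs.span_diff fs.span_base[of s]) blast+
    with orth show ?case by (intro bexI[of _ p'])
  qed
  then obtain p where p: "p \<in> fs.span S" "\<forall>s\<in>S. ip (x - p) s = 0" by blast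
  show ?thesis
  proof (intro bexI[OF _ p(1)] ballI)
    fix s assume "s \<in> fs.span S"
    then show "ip (x - p) s = 0" using orthogonal_span[of S "x - p"] p(2) by simp
  qed
qed

text \<open>Each new vector is replaced by its normalised difference from its projection, or dropped
  if that difference is zero.\<close>

lemma gram_schmidt:
  assumes "finite S" "S \<subseteq> supported J"
  shows "\<exists>E. finite E \<and> E \<subseteq> supported J \<and> fs.span E = fs.span S
    \<and> (\<forall>a\<in>E. \<forall>b\<in>E. ip a b = (if a = b then 1 else 0))"
  using assms
proof (induction S)
  case empty then show ?case by (intro exI[of _ "{}"]) auto
next
  case (insert s S)
  then obtain E where E: "finite E" "E \<subseteq> supported J" "fs.span E = fs.span S"
      "\<forall>a\<in>E. \<forall>b\<in>E. ip a b = (if a = b then 1 else 0)"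
    by auto
  obtain p where p: "p \<in> fs.span E" "\<forall>t\<in>fs.span E. ip (s - p) t = 0"
    using projection[OF E(1,2)] by blast
  have spn: "fs.span (insert s S) = fs.span (insert s E)"
    using E(3) by (simp add: fs.span_insert)
  show ?case
  proof (cases "s = p")
    case True
    then have "fs.span (insert s E) = fs.span E" using p(1) fs.span_redundant by blast
    then show ?thesis using E spn by auto
  next
    case False
    have "p \<in> supported J"
      using p(1) E(2) fs.span_minimal[OF _ subspace_supported] by blast
    then have supp: "s - p \<in> supported J"
      using insert.prems fs.subspace_diff[OF subspace_supported] by blast
    then obtain r :: real where r: "r > 0" "ip (s - p) (s - p) = of_real r"
      using pos[of "s - p"] False by auto
    define c :: 'f where "c = of_real (1 / sqrt r)"
    define e where "e = fscale c (s - p)"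
    have c: "c \<noteq> 0" "c * c * of_real r = 1" "conjugate c = c"
      using r(1) by (simp_all add: c_def flip: of_real_mult)
    have ee: "ip e e = 1"
      using c r by (simp add: e_def scale_left scale_right mult.assoc)
    have orth: "ip e a = 0" "ip a e = 0" if "a \<in> E" for a
      using p(2) fs.span_base[OF that] zero_commute by (auto simp: e_def scale_left scale_right)
    have "s = p + fscale (1 / c) e"
      using c(1) by (auto simp: e_def fun_eq_iff fun_apply)
    moreover have mono: "fs.span E \<subseteq> fs.span (insert y E)" for y
      by (rule fs.span_mono) blast
    then have "p \<in> fs.span (insert e E)" "e \<in> fs.span (insert e E)"
      using p(1) fs.span_base[of e "insert e E"] by blast+
    ultimately have "s \<in> fs.span (insert e E)"
      by (metis fs.span_add fs.span_scale)
    moreover have "e \<in> fs.span (insert s E)"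
      unfolding e_def using p(1) mono[of s]
      by (intro fs.span_scale fs.span_diff fs.span_base[of s]) blast+
    ultimately have "fs.span (insert e E) = fs.span (insert s E)"
      unfolding fs.span_eq by (auto intro: fs.span_base)
    moreover have "e \<in> supported J"
      unfolding e_def using supp fs.subspace_scale[OF subspace_supported] by blast
    ultimately show ?thesis
      using E ee orth spn by (intro exI[of _ "insert e E"]) auto
  qed
qed

end

subsection \<open>Orthonormal bases and frame bounds\<close>

text \<open>The Cauchy-Schwarz inequality, squared to be free of roots.\<close>

lemma sum_mult_squared_le:
  fixes a b :: "'a \<Rightarrow> real"
  shows "(\<Sum>i\<in>A. \<bar>a i\<bar> * \<bar>b i\<bar>)\<^sup>2 \<le> (\<Sum>i\<in>A. (a i)\<^sup>2) * (\<Sum>i\<in>A. (b i)\<^sup>2)"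
proof -
  have "(\<Sum>i\<in>A. \<bar>a i\<bar> * \<bar>b i\<bar>)\<^sup>2 \<le> (L2_set a A * L2_set b A)\<^sup>2"
    by (intro power_mono L2_set_mult_ineq sum_nonneg) simp
  then show ?thesis
    by (simp add: power_mult_distrib L2_set_def sum_nonneg)
qed

lemma independent_unit_fun:
  assumes "finite I"
  shows "fs.independent (unit_fun ` I :: ('i \<Rightarrow> 'f::field) set)"
proof (rule fs.independent_if_scalars_zero)
  have inj: "inj_on (unit_fun :: 'i \<Rightarrow> 'i \<Rightarrow> 'f) I"
    by (rule inj_onI) (metis unit_fun_def zero_neq_one)
  fix c :: "('i \<Rightarrow> 'f) \<Rightarrow> 'f" and y :: "'i \<Rightarrow> 'f"
  assume *: "(\<Sum>x\<in>unit_fun ` I. fscale (c x) x) = 0" and "y \<in> unit_fun ` I"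
  then obtain i where i: "i \<in> I" "y = unit_fun i" by blast
  have "0 = (\<Sum>j\<in>I. fscale (c (unit_fun j)) (unit_fun j)) i"
    using * by (simp add: sum.reindex[OF inj] zero_fun_apply)
  also have "\<dots> = c y"
    using i assms by (simp add: fun_apply unit_fun_def if_distrib cong: if_cong)
  finally show "c y = 0" by simp
qed (simp add: assms)

lemma dim_supported:
  assumes "finite I"
  shows "fs.dim (supported I :: ('i \<Rightarrow> 'f::field) set) = card I"
proof -
  have "inj_on (unit_fun :: 'i \<Rightarrow> 'i \<Rightarrow> 'f) I"
    by (rule inj_onI) (metis unit_fun_def zero_neq_one)
  then show ?thesis
    using fs.dim_span_eq_card_independent[OF independent_unit_fun[OF assms, where 'f='f]]
    by (simp add: card_image span_unit_fun[OF assms])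
qed

text \<open>The combinations indexed by \<open>V\<close> form a subspace containing the generators.
  Indexing by \<open>V\<close> rather than by the image allows repeated vectors.\<close>

lemma span_image_finite:
  assumes "finite V" "y \<in> fs.span (x ` V)"
  shows "\<exists>a. y = (\<Sum>v\<in>V. fscale (a v) (x v))"
proof -
  let ?R = "range (\<lambda>a. \<Sum>v\<in>V. fscale (a v) (x v))"
  have "fs.span (x ` V) \<subseteq> ?R"
  proof (rule fs.span_minimal)
    show "x ` V \<subseteq> ?R"
    proof
      fix y assume "y \<in> x ` V"
      then obtain u where "u \<in> V" "y = x u" by blast
      then have "y = (\<Sum>v\<in>V. fscale (unit_fun u v) (x v))"
        using assms(1) by (simp add: unit_fun_def if_distrib[of "\<lambda>c. fscale c _"] cong: if_cong)
      then show "y \<in> ?R" by blast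
    qed
    show "fs.subspace ?R"
    proof (rule fs.subspaceI)
      show "0 \<in> ?R" by (rule range_eqI[of _ _ "\<lambda>_. 0"]) simp
    next
      fix y z assume "y \<in> ?R" "z \<in> ?R"
      then obtain a b where "y = (\<Sum>v\<in>V. fscale (a v) (x v))" "z = (\<Sum>v\<in>V. fscale (b v) (x v))"
        by blast
      then have "y + z = (\<Sum>v\<in>V. fscale (a v + b v) (x v))"
        by (simp add: fs.scale_left_distrib sum.distrib)
      then show "y + z \<in> ?R" by (rule range_eqI[of _ _ "\<lambda>v. a v + b v"])
    next
      fix c y assume "y \<in> ?R"
      then obtain a where "y = (\<Sum>v\<in>V. fscale (a v) (x v))" by blast
      then have "fscale c y = (\<Sum>v\<in>V. fscale (c * a v) (x v))"
        by (simp add: fs.scale_sum_right)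
      then show "fscale c y \<in> ?R" by (rule range_eqI[of _ _ "\<lambda>v. c * a v"])
    qed
  qed
  then show ?thesis using assms(2) by blast
qed

context pos_form
begin

text \<open>Gram-Schmidt on the unit functions yields an orthonormal set spanning
  \<open>supported J\<close>. Being independent, it has \<open>card J\<close> elements and can be
  indexed by \<open>J\<close> itself.\<close>

lemma orthonormal_basis:
  assumes "finite J"
  obtains e :: "'i \<Rightarrow> 'i \<Rightarrow> 'f"
  where "\<And>j. j \<in> J \<Longrightarrow> e j \<in> supported J"
    and "\<And>j k. j \<in> J \<Longrightarrow> k \<in> J \<Longrightarrow> ip (e j) (e k) = (if j = k then 1 else 0)"
    and "\<And>x. x \<in> supported J \<Longrightarrow> x = (\<Sum>j\<in>J. fscale (ip x (e j)) (e j))"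
proof -
  have "unit_fun ` J \<subseteq> (supported J :: ('i \<Rightarrow> 'f) set)"
    using span_unit_fun[OF assms, where 'f='f] fs.span_superset by metis
  then obtain E where E: "finite E" "E \<subseteq> supported J" "fs.span E = supported J"
      "\<forall>a\<in>E. \<forall>b\<in>E. ip a b = (if a = b then 1 else 0)"
    using gram_schmidt[of "unit_fun ` J"] assms span_unit_fun[OF assms, where 'f='f] by auto
  have "fs.independent E"
  proof (rule fs.independent_if_scalars_zero[OF E(1)])
    fix c y assume *: "(\<Sum>x\<in>E. fscale (c x) x) = 0" "y \<in> E"
    have "0 = ip (\<Sum>x\<in>E. fscale (c x) x) y" using * by simp
    also have "\<dots> = (\<Sum>x\<in>E. if x = y then c x else 0)"
      using E(4) *(2) by (auto simp: sum_left scale_left intro!: sum.cong)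
    finally show "c y = 0" using E(1) *(2) by simp
  qed
  then have "card E = card J"
    using fs.dim_span_eq_card_independent[of E] E(3) dim_supported[OF assms, where 'f='f] by simp
  then obtain e where e: "bij_betw e J E"
    using assms E(1) finite_same_card_bij by metis
  show thesis
  proof (rule that[of e])
    show "e j \<in> supported J" if "j \<in> J" for j
      using e E(2) that bij_betwE by blast
    show "ip (e j) (e k) = (if j = k then 1 else 0)" if "j \<in> J" "k \<in> J" for j k
      using E(4) e that by (metis bij_betwE bij_betw_imp_inj_on inj_on_contraD)
    fix x :: "'i \<Rightarrow> 'f" assume x: "x \<in> supported J"
    let ?y = "\<Sum>a\<in>E. fscale (ip x a) a"
    have "?y \<in> fs.span E" by (intro fs.span_sum fs.span_scale fs.span_base)
    then have xy: "x - ?y \<in> fs.span E" using x E(3) by (auto intro: fs.span_diff)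
    have "ip (x - ?y) a = 0" if "a \<in> E" for a
    proof -
      have "ip ?y a = (\<Sum>b\<in>E. if b = a then ip x b else 0)"
        using E(4) that by (auto simp: sum_left scale_left intro!: sum.cong)
      then show ?thesis using E(1) that by (simp add: diff_left)
    qed
    \<comment> \<open>The remainder lies in the span of \<open>E\<close> and is orthogonal to
      \<open>E\<close>, hence to itself.\<close>
    then have "ip (x - ?y) (x - ?y) = 0"
      using orthogonal_span[OF _ xy] by blast
    then have "x = ?y" using eq_0[of "x - ?y"] xy E(3) by simp
    then show "x = (\<Sum>j\<in>J. fscale (ip x (e j)) (e j))"
      using sum.reindex_bij_betw[OF e, of "\<lambda>a. fscale (ip x a) a"] by simp
  qed
qed

end

text \<open>The standard Hermitian inner product of the coordinates in \<open>I\<close>,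
  conjugate-linear in the second argument.\<close>

definition sip :: "'i set \<Rightarrow> ('i \<Rightarrow> 'f::rc_field) \<Rightarrow> ('i \<Rightarrow> 'f) \<Rightarrow> 'f" where
  "sip I x y = (\<Sum>i\<in>I. x i * conjugate (y i))"

lemma sip_self: "sip I x x = of_real (\<Sum>i\<in>I. (norm (x i))\<^sup>2)"
  by (simp add: sip_def mult_conjugate_self)

lemma pos_form_sip:
  assumes "finite I"
  shows "pos_form I (sip I :: ('i \<Rightarrow> 'f::rc_field) \<Rightarrow> _)"
proof
  fix x y z :: "'i \<Rightarrow> 'f" and a :: 'f
  show "sip I (x + y) z = sip I x z + sip I y z"
    by (simp add: sip_def fun_apply algebra_simps sum.distrib)
  show "sip I (fscale a x) z = a * sip I x z"
    by (simp add: sip_def fun_apply algebra_simps sum_distrib_left)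
  show "sip I y x = conjugate (sip I x y)"
    by (simp add: sip_def sum_conjugate[OF assms] conjugate_dist_mul mult.commute)
  assume x: "x \<in> supported I" "x \<noteq> 0"
  then obtain i where "i \<in> I" "x i \<noteq> 0"
    by (auto simp: supported_def fun_eq_iff zero_fun_apply)
  then have "(\<Sum>i\<in>I. (norm (x i))\<^sup>2) > 0"
    using assms by (intro sum_pos2[of I i]) auto
  then show "\<exists>r::real. r > 0 \<and> sip I x x = of_real r"
    using sip_self by blast
qed

lemma sip_unit_fun:
  assumes "finite I" "i \<in> I"
  shows "sip I x (unit_fun i) = x i"
  using assms by (simp add: sip_def unit_fun_def if_distrib[of conjugate] if_distrib[of "\<lambda>y. _ * y"] cong: if_cong)

text \<open>Both bounds are instances of Cauchy-Schwarz. For the upper one it is applied to each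
  \<open>sip I f (x v)\<close>; for the lower one, each coordinate of a vector \<open>f\<close> in
  the span is a fixed linear combination of the numbers \<open>sip I f (x v)\<close>.\<close>

lemma finite_frame_bounds:
  fixes x :: "'a \<Rightarrow> 'i \<Rightarrow> 'f::rc_field"
  assumes "finite V" "finite I" "x ` V \<subseteq> supported I"
  shows "\<exists>A B. 0 < A \<and> A \<le> B \<and> (\<forall>f \<in> fs.span (x ` V).
    A * norm (sip I f f) \<le> (\<Sum>v\<in>V. (norm (sip I f (x v)))\<^sup>2)
    \<and> (\<Sum>v\<in>V. (norm (sip I f (x v)))\<^sup>2) \<le> B * norm (sip I f f))"
proof -
  interpret pos_form I "sip I :: ('i \<Rightarrow> 'f) \<Rightarrow> _" by (rule pos_form_sip[OF assms(2)])
  define q where "q f = (\<Sum>i\<in>I. (norm (f i))\<^sup>2)" for f :: "'i \<Rightarrow> 'f"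
  have q: "norm (sip I f f) = q f" for f :: "'i \<Rightarrow> 'f"
    by (simp add: sip_self q_def sum_nonneg del: of_real_sum)
  have q_nonneg: "q f \<ge> 0" for f by (simp add: q_def sum_nonneg)
  \<comment> \<open>On the span, taking the coordinate \<open>i\<close> is the inner product with
    the projection of \<open>unit_fun i\<close>, and this projection is a combination of the vectors
    \<open>x v\<close>.\<close>
  have "\<exists>a. \<forall>f \<in> fs.span (x ` V). f i = (\<Sum>v\<in>V. conjugate (a v) * sip I f (x v))" if "i \<in> I" for i
  proof -
    obtain p where p: "p \<in> fs.span (x ` V)" "\<forall>s\<in>fs.span (x ` V). sip I (unit_fun i - p) s = 0"
      using projection[of "x ` V" "unit_fun i"] assms by blast
    obtain a where a: "p = (\<Sum>v\<in>V. fscale (a v) (x v))"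
      using span_image_finite[OF assms(1) p(1)] by blast
    have "f i = (\<Sum>v\<in>V. conjugate (a v) * sip I f (x v))" if "f \<in> fs.span (x ` V)" for f
    proof -
      have "sip I f (unit_fun i - p) = 0" using p(2) that zero_commute by blast
      then have "f i = sip I f p"
        using sip_unit_fun[OF assms(2) \<open>i \<in> I\<close>, of f] by (simp add: diff_right)
      then show ?thesis by (simp add: a sum_right scale_right)
    qed
    then show ?thesis by blast
  qed
  then obtain a where a: "\<And>i f. i \<in> I \<Longrightarrow> f \<in> fs.span (x ` V)
      \<Longrightarrow> f i = (\<Sum>v\<in>V. conjugate (a i v) * sip I f (x v))"
    by metis
  define C where "C = (\<Sum>i\<in>I. \<Sum>v\<in>V. (norm (a i v))\<^sup>2)"
  define D where "D = (\<Sum>v\<in>V. q (x v))"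
  have C: "C \<ge> 0" and D: "D \<ge> 0" using q_nonneg by (simp_all add: C_def D_def sum_nonneg)
  show ?thesis
  \<comment> \<open>Adding 1 keeps the lower constant positive when \<open>C\<close> is zero and
    gives \<open>1 / (C + 1) \<le> 1 \<le> D + 1\<close>.\<close>
  proof (rule exI[of _ "1 / (C + 1)"], rule exI[of _ "D + 1"], intro conjI ballI)
    show "0 < 1 / (C + 1)" using C by simp
    have "1 / (C + 1) \<le> 1" using C by simp
    then show "1 / (C + 1) \<le> D + 1" using D by linarith
    fix f assume f: "f \<in> fs.span (x ` V)"
    define Q where "Q = (\<Sum>v\<in>V. (norm (sip I f (x v)))\<^sup>2)"
    have Q: "Q \<ge> 0" by (simp add: Q_def sum_nonneg)
    have "q f \<le> (\<Sum>i\<in>I. (\<Sum>v\<in>V. (norm (a i v))\<^sup>2) * Q)"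
      unfolding q_def
    proof (rule sum_mono)
      fix i assume "i \<in> I"
      have "norm (f i) \<le> (\<Sum>v\<in>V. \<bar>norm (a i v)\<bar> * \<bar>norm (sip I f (x v))\<bar>)"
        unfolding a[OF \<open>i \<in> I\<close> f] by (rule order_trans[OF norm_sum]) (simp add: norm_mult)
      then have "(norm (f i))\<^sup>2 \<le> (\<Sum>v\<in>V. \<bar>norm (a i v)\<bar> * \<bar>norm (sip I f (x v))\<bar>)\<^sup>2"
        by (rule power_mono) simp
      also have "\<dots> \<le> (\<Sum>v\<in>V. (norm (a i v))\<^sup>2) * Q"
        unfolding Q_def by (rule sum_mult_squared_le)
      finally show "(norm (f i))\<^sup>2 \<le> (\<Sum>v\<in>V. (norm (a i v))\<^sup>2) * Q" .
    qed
    also have "\<dots> = C * Q" by (simp add: C_def sum_distrib_right)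
    also have "\<dots> \<le> (C + 1) * Q" using Q by (simp add: algebra_simps)
    finally show "1 / (C + 1) * norm (sip I f f) \<le> (\<Sum>v\<in>V. (norm (sip I f (x v)))\<^sup>2)"
      using C by (simp add: q divide_simps mult.commute flip: Q_def)
    have "Q \<le> (\<Sum>v\<in>V. q f * q (x v))"
      unfolding Q_def
    proof (rule sum_mono)
      fix v
      have "norm (sip I f (x v)) \<le> (\<Sum>i\<in>I. \<bar>norm (f i)\<bar> * \<bar>norm (x v i)\<bar>)"
        unfolding sip_def by (rule order_trans[OF norm_sum]) (simp add: norm_mult)
      then have "(norm (sip I f (x v)))\<^sup>2 \<le> (\<Sum>i\<in>I. \<bar>norm (f i)\<bar> * \<bar>norm (x v i)\<bar>)\<^sup>2"
        by (rule power_mono) simp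
      also have "\<dots> \<le> q f * q (x v)"
        unfolding q_def by (rule sum_mult_squared_le)
      finally show "(norm (sip I f (x v)))\<^sup>2 \<le> q f * q (x v)" .
    qed
    also have "\<dots> = D * q f" by (simp add: D_def sum_distrib_left mult.commute)
    also have "\<dots> \<le> (D + 1) * q f" using q_nonneg by (simp add: algebra_simps)
    finally show "(\<Sum>v\<in>V. (norm (sip I f (x v)))\<^sup>2) \<le> (D + 1) * norm (sip I f f)"
      by (simp add: q flip: Q_def)
  qed
qed

subsection \<open>Frame graphs in standard inner product spaces\<close>

text \<open>A digraph isomorphism carries separate maps on vertices and arcs as well as end maps.
  With \<open>fst\<close> and \<open>snd\<close> as tail and head, the arc map must agree with
  \<open>map_prod h h\<close> on the arcs. Well-formedness of \<open>F\<close> stays because it is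
  part of being an isomorphism.\<close>

lemma digraph_iso_with_proj:
  "digraph_iso (with_proj F) (with_proj G) \<longleftrightarrow>
    pair_wf_digraph F \<and> (\<exists>h. bij_betw h (pverts F) (pverts G) \<and> parcs G = map_prod h h ` parcs F)"
proof
  assume "digraph_iso (with_proj F) (with_proj G)"
  then obtain f where f: "pre_digraph.digraph_isomorphism (with_proj F) f"
      "with_proj G = app_iso f (with_proj F)"
    unfolding digraph_iso_def by blast
  let ?h = "iso_verts f"
  have wf: "pair_wf_digraph F"
    using f(1) by (simp add: pre_digraph.digraph_isomorphism_def wf_digraph_wp_iff)
  have verts: "pverts G = ?h ` pverts F" and arcs: "parcs G = iso_arcs f ` parcs F"
    and ends: "iso_tail f = fst" "iso_head f = snd"
    using f(2) by (simp_all add: app_iso_def with_proj_def)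
  have "iso_arcs f e = map_prod ?h ?h e" if "e \<in> parcs F" for e
    using f(1) that by (auto simp: pre_digraph.digraph_isomorphism_def ends prod_eq_iff)
  then have "parcs G = map_prod ?h ?h ` parcs F"
    unfolding arcs by (rule image_cong[OF refl])
  moreover have "bij_betw ?h (pverts F) (pverts G)"
    using f(1) verts by (simp add: pre_digraph.digraph_isomorphism_def bij_betw_def)
  ultimately show "pair_wf_digraph F \<and>
      (\<exists>h. bij_betw h (pverts F) (pverts G) \<and> parcs G = map_prod h h ` parcs F)"
    using wf by blast
next
  assume "pair_wf_digraph F \<and>
      (\<exists>h. bij_betw h (pverts F) (pverts G) \<and> parcs G = map_prod h h ` parcs F)"
  then obtain h where wf: "pair_wf_digraph F" and h: "bij_betw h (pverts F) (pverts G)"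
      "parcs G = map_prod h h ` parcs F"
    by blast
  let ?f = "\<lparr>iso_verts = h, iso_arcs = map_prod h h, iso_head = snd, iso_tail = fst\<rparr>"
  have "parcs F \<subseteq> pverts F \<times> pverts F"
    using wf by (auto simp: pair_wf_digraph_def)
  then have "inj_on (map_prod h h) (parcs F)"
    using map_prod_inj_on bij_betw_imp_inj_on[OF h(1)] inj_on_subset by blast
  then have "pre_digraph.digraph_isomorphism (with_proj F) ?f"
    using wf bij_betw_imp_inj_on[OF h(1)]
    by (simp add: pre_digraph.digraph_isomorphism_def wf_digraph_wp_iff)
  moreover have "with_proj G = app_iso ?f (with_proj F)"
    using h(2) bij_betw_imp_surj_on[OF h(1)] by (simp add: app_iso_def with_proj_def)
  ultimately show "digraph_iso (with_proj F) (with_proj G)"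
    unfolding digraph_iso_def by blast
qed

text \<open>Vectors realising \<open>G\<close> under the standard inner product. They need not span
  \<open>supported I\<close>: the dimension of interest is that of their span, which makes it easy
  to enlarge the surrounding space.\<close>

definition represents ::
  "'i set \<Rightarrow> ('a \<Rightarrow> 'i \<Rightarrow> 'f::rc_field) \<Rightarrow> 'a pair_pre_digraph \<Rightarrow> bool" where
  "represents I x G \<longleftrightarrow> finite I \<and> x ` pverts G \<subseteq> supported I \<and>
    (\<forall>u\<in>pverts G. \<forall>v\<in>pverts G. u \<noteq> v \<longrightarrow> ((u, v) \<in> parcs G \<longleftrightarrow> sip I (x u) (x v) \<noteq> 0))"

text \<open>Coordinates with respect to an orthonormal basis turn the given inner product into the
  standard one. The lower frame bound shows that the frame spans, so the dimension is exactly
  \<open>d\<close>.\<close>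

lemma is_frame_graph_represents:
  assumes "is_frame_graph TYPE('f::rc_field) d G"
  obtains x :: "'a \<Rightarrow> nat \<Rightarrow> 'f::rc_field"
  where "represents {..<d} x (G :: 'a pair_pre_digraph)" "fs.dim (x ` pverts G) = d"
proof -
  obtain ip :: "'f vec \<Rightarrow> 'f vec \<Rightarrow> 'f" and \<phi> where vip: "vec_inner_product d ip"
    and frame: "finite_frame d ip \<phi>" and iso: "digraph_iso (with_proj (frame_graph ip \<phi>)) (with_proj G)"
    using assms unfolding is_frame_graph_def by blast
  interpret v: vec_inner_product d ip by (rule vip)
  obtain h where h: "bij_betw h {..<length \<phi>} (pverts G)"
    and arcs: "parcs G = map_prod h h ` parcs (frame_graph ip \<phi>)"
    using iso by (auto simp: digraph_iso_with_proj frame_graph_def)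
  let ?J = "{..<d}"
  \<comment> \<open>The inner product on \<open>carrier_vec d\<close>, read as a form on
    functions.\<close>
  define jp :: "(nat \<Rightarrow> 'f) \<Rightarrow> (nat \<Rightarrow> 'f) \<Rightarrow> 'f" where "jp x y = ip (vec d x) (vec d y)" for x y
  interpret pos_form ?J jp
  proof
    fix x y z :: "nat \<Rightarrow> 'f" and a :: 'f
    have "vec d (x + y) = vec d x + vec d y" by (auto simp: fun_apply)
    then show "jp (x + y) z = jp x z + jp y z"
      by (simp add: jp_def v.ip_add)
    have "vec d (fscale a x) = a \<cdot>\<^sub>v vec d x" by (auto simp: fun_apply)
    then show "jp (fscale a x) z = a * jp x z"
      by (simp add: jp_def v.ip_smult)
    show "jp y x = conjugate (jp x y)"
      unfolding jp_def by (rule v.ip_conjugate) simp_all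
    assume x: "x \<in> supported {..<d}" "x \<noteq> 0"
    have "vec d x \<noteq> 0\<^sub>v d"
    proof
      assume *: "vec d x = 0\<^sub>v d"
      have "x i = 0" for i
        using x(1) arg_cong[OF *, of "\<lambda>w. w $ i"] by (cases "i < d") (auto simp: supported_def)
      then show False using x(2) by (simp add: fun_eq_iff zero_fun_apply)
    qed
    then show "\<exists>r::real. r > 0 \<and> jp x x = of_real r"
      unfolding jp_def by (intro v.ip_pos) simp_all
  qed
  obtain e :: "nat \<Rightarrow> nat \<Rightarrow> 'f" where e: "\<And>j. j \<in> ?J \<Longrightarrow> e j \<in> supported ?J"
    "\<And>j k. j \<in> ?J \<Longrightarrow> k \<in> ?J \<Longrightarrow> jp (e j) (e k) = (if j = k then 1 else 0)"
    "\<And>x. x \<in> supported ?J \<Longrightarrow> x = (\<Sum>j\<in>?J. fscale (jp x (e j)) (e j))"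
    by (rule orthonormal_basis) auto
  \<comment> \<open>\<open>T\<close> takes the coordinates with respect to the basis
    \<open>e\<close>.\<close>
  define T where "T f = (\<lambda>j. if j < d then jp f (e j) else 0)" for f
  \<comment> \<open>Parseval: only \<open>f\<close> is expanded, while \<open>g\<close> enters
    through its inner products with the basis.\<close>
  have jp_T: "jp f g = sip ?J (T f) (T g)" if "f \<in> supported ?J" for f g
  proof -
    have "jp f g = (\<Sum>j\<in>?J. jp f (e j) * jp (e j) g)"
      by (subst e(3)[OF that]) (simp add: sum_left scale_left)
    also have "\<dots> = sip ?J (T f) (T g)"
      unfolding sip_def by (intro sum.cong refl) (simp add: T_def conj[of g])
    finally show ?thesis .
  qed
  define f where "f i = (\<lambda>j. if j < d then \<phi> ! i $ j else 0)" for i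
  have f: "f i \<in> supported ?J" for i by (simp add: f_def supported_def)
  have vec_f: "vec d (f i) = \<phi> ! i" if "i < length \<phi>" for i
    using frame nth_mem[OF that] by (auto simp: finite_frame_def f_def intro!: eq_vecI)
  define g where "g = the_inv_into {..<length \<phi>} h"
  have g: "bij_betw g (pverts G) {..<length \<phi>}" and gh: "\<And>i. i < length \<phi> \<Longrightarrow> g (h i) = i"
    using h bij_betw_the_inv_into[OF h] by (auto simp: g_def the_inv_into_f_f bij_betw_def)
  define x where "x v = T (f (g v))" for v
  have lt: "g u < length \<phi>" if "u \<in> pverts G" for u using g that bij_betwE by blast
  have sip_x: "sip ?J (x u) (x v) = ip (\<phi> ! g u) (\<phi> ! g v)" if "u \<in> pverts G" "v \<in> pverts G" for u v
    using jp_T[OF f, of "g u" "f (g v)"] lt that by (simp add: x_def jp_def vec_f)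
  have hg: "h (g u) = u" if "u \<in> pverts G" for u
    using h that by (simp add: g_def f_the_inv_into_f_bij_betw)
  have "represents ?J x G"
    unfolding represents_def
  proof (intro conjI ballI impI)
    show "x ` pverts G \<subseteq> supported ?J" by (auto simp: x_def T_def supported_def)
    fix u v assume uv: "u \<in> pverts G" "v \<in> pverts G" "u \<noteq> v"
    have "(u, v) \<in> parcs G \<longleftrightarrow> (g u, g v) \<in> parcs (frame_graph ip \<phi>)"
    proof
      assume "(u, v) \<in> parcs G"
      then show "(g u, g v) \<in> parcs (frame_graph ip \<phi>)"
        unfolding arcs by (auto simp: frame_graph_def gh)
    next
      assume "(g u, g v) \<in> parcs (frame_graph ip \<phi>)"
      then show "(u, v) \<in> parcs G"
        unfolding arcs using uv hg by (metis map_prod_simp rev_image_eqI)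
    qed
    also have "\<dots> \<longleftrightarrow> sip ?J (x u) (x v) \<noteq> 0"
      using uv lt hg by (auto simp: frame_graph_def sip_x) metis
    finally show "(u, v) \<in> parcs G \<longleftrightarrow> sip ?J (x u) (x v) \<noteq> 0" .
  qed simp
  moreover have "fs.dim (x ` pverts G) = d"
  proof -
    let ?S = "x ` pverts G"
    have fin: "finite ?S" using bij_betw_finite[OF h] by simp
    have sub: "?S \<subseteq> supported ?J" by (auto simp: x_def T_def supported_def)
    have "supported ?J \<subseteq> fs.span ?S"
    proof
      fix y :: "nat \<Rightarrow> 'f" assume y: "y \<in> supported ?J"
      interpret s: pos_form ?J "sip ?J :: (nat \<Rightarrow> 'f) \<Rightarrow> _" by (rule pos_form_sip) simp
      obtain p where p: "p \<in> fs.span ?S" "\<forall>s\<in>fs.span ?S. sip ?J (y - p) s = 0"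
        using s.projection[OF fin sub] by blast
      have "p \<in> supported ?J" using p(1) fs.span_minimal[OF sub subspace_supported] by blast
      then have supp: "y - p \<in> supported ?J" using y by (auto simp: supported_def fun_apply)
      \<comment> \<open>The preimage under \<open>T\<close> of the remainder \<open>y - p\<close>.
        It is orthogonal to every frame vector, so the lower frame bound forces it to be
        zero.\<close>
      define z where "z = (\<Sum>j\<in>?J. fscale ((y - p) j) (e j))"
      have z: "z \<in> supported ?J"
        unfolding z_def by (intro fs.subspace_sum fs.subspace_scale subspace_supported e(1))
      have "T z j = (y - p) j" for j
      proof (cases "j < d")
        case True
        then have "jp z (e j) = (\<Sum>k\<in>?J. if k = j then (y - p) k else 0)"
          unfolding z_def sum_left scale_left by (intro sum.cong refl) (simp add: e(2))
        then show ?thesis using True by (simp add: T_def)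
      qed (use supp in \<open>simp add: T_def supported_def\<close>)
      then have Tz: "T z = y - p" by blast
      have "ip (vec d z) (\<phi> ! i) = 0" if "i < length \<phi>" for i
      proof -
        have "h i \<in> pverts G" using h that bij_betwE by blast
        then have "x (h i) \<in> fs.span ?S" by (intro fs.span_base) simp
        then have "sip ?J (y - p) (x (h i)) = 0" using p(2) by blast
        then have "jp z (f i) = 0" using jp_T[OF z] Tz gh[OF that] by (simp add: x_def)
        then show ?thesis by (simp add: jp_def vec_f[OF that])
      qed
      then have sum0: "(\<Sum>i<length \<phi>. (norm (ip (vec d z) (\<phi> ! i)))\<^sup>2) = 0"
        by simp
      obtain A where A: "A > 0"
        "A * (ip_norm ip (vec d z))\<^sup>2 \<le> (\<Sum>i<length \<phi>. (norm (ip (vec d z) (\<phi> ! i)))\<^sup>2)"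
        using frame unfolding finite_frame_def by (metis vec_carrier)
      have "norm (jp z z) \<le> 0"
        using A by (simp add: sum0 ip_norm_def jp_def mult_le_0_iff)
      then have "z = 0" using eq_0[OF z] by simp
      moreover have "T 0 = 0" by (rule ext) (simp add: T_def zero_fun_apply)
      ultimately have "y - p = 0" using Tz by simp
      then show "y \<in> fs.span ?S" using p(1) by simp
    qed
    then have "d \<le> fs.dim ?S"
      using dim_mono_finite[OF fin] dim_supported[of ?J, where 'f='f] by (metis card_lessThan finite_lessThan)
    then show ?thesis using dim_supported_le[OF _ sub] by simp
  qed
  ultimately show thesis by (rule that)
qed

text \<open>The standard inner product is pulled back to \<open>carrier_vec d\<close> along the
  coordinates of a basis of the span. As the inner product there may be arbitrary, any basis serves,
  orthonormal or not.\<close>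

lemma represents_is_frame_graph:
  fixes x :: "'a \<Rightarrow> 'i \<Rightarrow> 'f::rc_field"
  assumes rep: "represents I x G" and G: "pair_digraph G"
  shows "is_frame_graph TYPE('f::rc_field) (fs.dim (x ` pverts G)) G"
proof -
  interpret pair_digraph G by (rule G)
  define d where "d = fs.dim (x ` pverts G)"
  have I: "finite I" and supp: "x ` pverts G \<subseteq> supported I"
    using rep by (auto simp: represents_def)
  interpret s: pos_form I "sip I :: ('i \<Rightarrow> 'f) \<Rightarrow> _" by (rule pos_form_sip[OF I])
  obtain B where B: "B \<subseteq> x ` pverts G" "finite B" "fs.independent B" "fs.span B = fs.span (x ` pverts G)"
    "card B = d"
    unfolding d_def by (rule basis_of_finite[of "x ` pverts G"]) (use pair_finite_verts in auto)
  obtain b where b: "bij_betw b {..<d} B"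
    using ex_bij_betw_nat_finite[OF B(2)] B(5) by (auto simp: atLeast0LessThan)
  obtain h where h: "bij_betw h {..<card (pverts G)} (pverts G)"
    using ex_bij_betw_nat_finite[OF pair_finite_verts] by (auto simp: atLeast0LessThan)
  let ?N = "card (pverts G)"
  \<comment> \<open>A linear bijection from \<open>carrier_vec d\<close> onto the span of the
    vectors \<open>x v\<close>.\<close>
  define T where "T c = (\<Sum>l<d. fscale (c $ l) (b l))" for c
  have T_add: "T (c + c') = T c + T c'" if "c \<in> carrier_vec d" "c' \<in> carrier_vec d" for c c'
    using that by (simp add: T_def fs.scale_left_distrib sum.distrib)
  have T_smult: "T (a \<cdot>\<^sub>v c) = fscale a (T c)" if "c \<in> carrier_vec d" for a c
    using that by (simp add: T_def fs.scale_sum_right)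
  have T_span: "T c \<in> fs.span (x ` pverts G)" for c
    unfolding T_def B(4)[symmetric]
    by (intro fs.span_sum fs.span_scale fs.span_base) (use b bij_betwE in blast)
  have T_supp: "T c \<in> supported I" for c
    using T_span fs.span_minimal[OF supp subspace_supported] by blast
  have T_inj: "c = 0\<^sub>v d" if "c \<in> carrier_vec d" "T c = 0" for c
  proof (rule eq_vecI)
    fix l assume "l < dim_vec (0\<^sub>v d :: 'f vec)"
    then have l: "l < d" by simp
    \<comment> \<open>Transfers coefficients indexed by positions to coefficients indexed by basis
      vectors, the form in which independence applies.\<close>
    let ?c = "\<lambda>y. c $ the_inv_into {..<d} b y"
    have "T c = (\<Sum>l<d. fscale (?c (b l)) (b l))"
      using b unfolding T_def by (intro sum.cong refl) (simp add: the_inv_into_f_f bij_betw_def)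
    also have "\<dots> = (\<Sum>y\<in>B. fscale (?c y) y)"
      using sum.reindex_bij_betw[OF b, of "\<lambda>y. fscale (?c y) y"] by simp
    finally have "?c (b l) = 0"
      using fs.independentD[OF B(3,2), of ?c "b l"] that(2) b l bij_betwE by fastforce
    then show "c $ l = 0\<^sub>v d $ l" using b l by (simp add: the_inv_into_f_f bij_betw_def)
  qed (use that in simp)
  have T_surj: "\<exists>c. c \<in> carrier_vec d \<and> T c = y" if "y \<in> fs.span (x ` pverts G)" for y
  proof -
    have "y \<in> fs.span (b ` {..<d})" using that B(4) b by (simp add: bij_betw_def)
    then obtain a where "y = (\<Sum>l<d. fscale (a l) (b l))"
      using span_image_finite[of "{..<d}"] by blast
    then have "T (vec d a) = y" by (simp add: T_def)
    then show ?thesis by (intro exI[of _ "vec d a"]) simp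
  qed
  define ip where "ip c c' = sip I (T c) (T c')" for c c'
  define \<phi> where "\<phi> = map (\<lambda>i. SOME c. c \<in> carrier_vec d \<and> T c = x (h i)) [0..<?N]"
  have hV: "h i \<in> pverts G" if "i < ?N" for i using h that bij_betwE by blast
  have \<phi>: "\<phi> ! i \<in> carrier_vec d" "T (\<phi> ! i) = x (h i)" if "i < ?N" for i
    using someI_ex[OF T_surj, of "x (h i)"] hV[OF that] that
    by (auto simp: \<phi>_def intro: fs.span_base)
  have len: "length \<phi> = ?N" by (simp add: \<phi>_def)
  have "vec_inner_product d ip"
  proof
    fix c c' c'' :: "'f vec" and a
    assume c: "c \<in> carrier_vec d" "c' \<in> carrier_vec d"
    show "ip (a \<cdot>\<^sub>v c) c' = a * ip c c'"
      using c by (simp add: ip_def T_smult s.scale_left)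
    show "ip c' c = conjugate (ip c c')"
      unfolding ip_def by (rule s.conj)
    show "ip (c + c') c'' = ip c c'' + ip c' c''"
      using c by (simp add: ip_def T_add s.add_left)
  next
    fix c :: "'f vec" assume "c \<in> carrier_vec d" "c \<noteq> 0\<^sub>v d"
    then show "\<exists>r::real. r > 0 \<and> ip c c = of_real r"
      unfolding ip_def using T_inj T_supp by (intro s.pos) auto
  qed
  moreover have "finite_frame d ip \<phi>"
  proof -
    obtain A A' where A: "0 < A" "A \<le> A'" "\<And>f. f \<in> fs.span (x ` pverts G) \<Longrightarrow>
        A * norm (sip I f f) \<le> (\<Sum>v\<in>pverts G. (norm (sip I f (x v)))\<^sup>2)
        \<and> (\<Sum>v\<in>pverts G. (norm (sip I f (x v)))\<^sup>2) \<le> A' * norm (sip I f f)"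
      using finite_frame_bounds[OF pair_finite_verts I supp] by blast
    have "(\<Sum>i<length \<phi>. (norm (ip c (\<phi> ! i)))\<^sup>2) = (\<Sum>v\<in>pverts G. (norm (sip I (T c) (x v)))\<^sup>2)" for c
      using sum.reindex_bij_betw[OF h, of "\<lambda>v. (norm (sip I (T c) (x v)))\<^sup>2"]
      by (simp add: len ip_def \<phi>)
    moreover have "(ip_norm ip c)\<^sup>2 = norm (sip I (T c) (T c))" for c
      by (simp add: ip_norm_def ip_def)
    moreover have "set \<phi> \<subseteq> carrier_vec d"
      using \<phi>(1) by (auto simp: in_set_conv_nth len)
    ultimately show ?thesis
      unfolding finite_frame_def using A(1,2) A(3)[OF T_span] by (intro conjI exI[of _ A] exI[of _ A']) simp_all
  qed
  moreover have "digraph_iso (with_proj (frame_graph ip \<phi>)) (with_proj G)"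
    unfolding digraph_iso_with_proj
  proof (intro conjI exI[of _ h])
    show "pair_wf_digraph (frame_graph ip \<phi>)"
      by unfold_locales (auto simp: frame_graph_def)
    show "bij_betw h (pverts (frame_graph ip \<phi>)) (pverts G)"
      using h by (simp add: frame_graph_def len)
    have ip_\<phi>: "ip (\<phi> ! i) (\<phi> ! j) \<noteq> 0 \<longleftrightarrow> (h i, h j) \<in> parcs G" if "i < ?N" "j < ?N" "i \<noteq> j" for i j
    proof -
      have "h i \<noteq> h j" using h that by (auto simp: bij_betw_def dest: inj_onD)
      then show ?thesis using rep hV that by (simp add: represents_def ip_def \<phi>)
    qed
    show "parcs G = map_prod h h ` parcs (frame_graph ip \<phi>)"
    proof (intro equalityI subsetI)
      fix a assume a: "a \<in> parcs G"
      obtain u v where uv: "a = (u, v)" by force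
      have "u \<in> pverts G" "v \<in> pverts G" "u \<noteq> v"
        using a uv in_arcsD1 in_arcsD2 no_loops' by auto
      moreover have "h ` {..<?N} = pverts G" using h by (simp add: bij_betw_def)
      ultimately have "u \<in> h ` {..<?N}" "v \<in> h ` {..<?N}" by simp_all
      with \<open>u \<noteq> v\<close> obtain i j where ij: "i < ?N" "j < ?N" "u = h i" "v = h j" "i \<noteq> j"
        by blast
      then have "(i, j) \<in> parcs (frame_graph ip \<phi>)"
        using a uv ip_\<phi> by (simp add: frame_graph_def len)
      then show "a \<in> map_prod h h ` parcs (frame_graph ip \<phi>)"
        using uv ij by (intro image_eqI[of _ _ "(i, j)"]) auto
    next
      fix a assume "a \<in> map_prod h h ` parcs (frame_graph ip \<phi>)"
      then show "a \<in> parcs G" using ip_\<phi> by (auto simp: frame_graph_def len)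
    qed
  qed
  ultimately show ?thesis unfolding is_frame_graph_def d_def by blast
qed

subsection \<open>Reflections and projections\<close>

context pos_form
begin

text \<open>\<open>U\<close> is the reflection in the hyperplane orthogonal to \<open>v\<close>, and
  the identity if \<open>v = 0\<close>. Clearing the denominator makes orthogonality of
  \<open>a\<close> and \<open>U b\<close> an equation of degree two in \<open>v\<close>.\<close>

lemma reflection:
  fixes v
  defines "U \<equiv> (\<lambda>y. y - fscale (2 * ip y v / ip v v) v)"
  assumes v: "v \<in> supported J"
  shows "ip (U y) (U z) = ip y z"
    and "ip v v \<noteq> 0 \<Longrightarrow> ip a (U b) = 0 \<longleftrightarrow> ip a b * ip v v = 2 * ip a v * ip v b"
proof -
  have right: "ip a (U b) = ip a b - 2 * ip v b / ip v v * ip a v" for a b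
    using conj[of v v] by (simp add: U_def diff_right scale_right conjugate_dist_mul conj[of v b, symmetric])
  have left: "ip (U y) x = ip y x - 2 * ip y v / ip v v * ip v x" for x
    by (simp add: U_def diff_left scale_left)
  show "ip (U y) (U z) = ip y z"
  proof (cases "v = 0")
    case False
    then have "ip v v \<noteq> 0" using eq_0[OF v] by blast
    then show ?thesis by (simp add: left right field_simps)
  qed (simp add: U_def)
  show "ip a (U b) = 0 \<longleftrightarrow> ip a b * ip v v = 2 * ip a v * ip v b" if "ip v v \<noteq> 0"
    using that by (simp add: right field_simps)
qed

text \<open>For each pair, the condition fails only on the zero set of a nonzero quadratic form in \<open>v\<close>;
  restricting these forms to a line shows that finitely many of them have a common non-zero.\<close>

lemma exists_reflection_vector:
  assumes "finite P" "\<And>a b. (a, b) \<in> P \<Longrightarrow> a \<in> supported J - {0} \<and> b \<in> supported J - {0}"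
  shows "\<exists>v\<in>supported J. \<forall>(a, b)\<in>P. ip a b * ip v v \<noteq> 2 * ip a v * ip v b"
proof -
  define q where "q = (\<lambda>(a, b) v. ip a b * ip v v - 2 * ip a v * ip v b)"
  have "\<exists>v\<in>supported J. \<forall>s\<in>P. q s v \<noteq> 0"
    using assms
  proof (induction P)
    case empty
    then show ?case by (auto simp: supported_def)
  next
    case (insert s P)
    obtain a b where s: "s = (a, b)" by force
    have ab: "a \<in> supported J" "b \<in> supported J" "a \<noteq> 0" "b \<noteq> 0"
      using insert.prems[of a b] s by auto
    have ne: "ip a a \<noteq> 0" "ip b b \<noteq> 0" using ab eq_0 by auto
    \<comment> \<open>A vector at which the form of the new pair is nonzero: its value is
      \<open>- 2 * ip a a * ip b b\<close> if \<open>a\<close> and \<open>b\<close> are orthogonal,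
      and \<open>- ip a b * ip a a\<close> otherwise.\<close>
    define w where "w = (if ip a b = 0 then a + b else a)"
    have w: "w \<in> supported J" using ab by (simp add: w_def fs.subspace_add[OF subspace_supported])
    have qw: "q s w \<noteq> 0"
      using ne zero_commute[of a b] by (auto simp: q_def s w_def add_left add_right)
    have "\<exists>v\<in>supported J. \<forall>s\<in>P. q s v \<noteq> 0"
      by (rule insert.IH) (use insert.prems in blast)
    then obtain v where v: "v \<in> supported J" "\<forall>s\<in>P. q s v \<noteq> 0" by blast
    \<comment> \<open>The linear coefficient along the line \<open>v + t w\<close>. The parameter is
      real, hence fixed by conjugation, so each form becomes a polynomial in it.\<close>
    define l where "l = (\<lambda>(a, b). ip a b * (ip v w + ip w v) - 2 * (ip a v * ip w b + ip a w * ip v b))"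
    have q_line: "q r (v + fscale (of_real t) w) = poly [:q r v, l r, q r w:] (of_real t)" for r t
      by (cases r) (simp add: q_def l_def add_left add_right scale_left scale_right algebra_simps)
    have "finite {t. q r (v + fscale (of_real t) w) = 0}" if "r \<in> insert s P" for r
    proof -
      \<comment> \<open>For \<open>r\<close> in \<open>P\<close> the constant coefficient is
        nonzero, for \<open>r = s\<close> the quadratic one.\<close>
      have "[:q r v, l r, q r w:] \<noteq> 0" using that qw v(2) by auto
      then have "finite {z. poly [:q r v, l r, q r w:] z = 0}" by (rule poly_roots_finite)
      then have "finite (of_real -` {z. poly [:q r v, l r, q r w:] z = 0} :: real set)"
        by (rule finite_vimageI) (simp add: inj_on_def)
      then show ?thesis by (simp only: q_line vimage_def mem_Collect_eq)
    qed
    then have "finite (\<Union>r\<in>insert s P. {t. q r (v + fscale (of_real t) w) = 0})"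
      using insert.hyps by simp
    then obtain t where "t \<notin> (\<Union>r\<in>insert s P. {t. q r (v + fscale (of_real t) w) = 0})"
      using ex_new_if_finite[OF infinite_UNIV_char_0[where 'a=real]] by blast
    then have "\<forall>r\<in>insert s P. q r (v + fscale (of_real t) w) \<noteq> 0" by simp
    moreover have "v + fscale (of_real t) w \<in> supported J"
      using v(1) w by (intro fs.subspace_add fs.subspace_scale subspace_supported)
    ultimately show ?case by (intro bexI[of _ "v + fscale (of_real t) w"])
  qed
  then show ?thesis by (fastforce simp: q_def)
qed

lemma exists_isometry_nonorthogonal:
  assumes "finite A" "finite B" "A \<subseteq> supported J - {0}" "B \<subseteq> supported J - {0}"
  obtains U where "\<And>y. y \<in> supported J \<Longrightarrow> U y \<in> supported J"
    and "\<And>y z. ip (U y) (U z) = ip y z"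
    and "\<And>a b. a \<in> A \<Longrightarrow> b \<in> B \<Longrightarrow> ip a (U b) \<noteq> 0"
proof -
  have fin: "finite (A \<times> B)" using assms by simp
  have mem: "a \<in> supported J - {0} \<and> b \<in> supported J - {0}" if "(a, b) \<in> A \<times> B" for a b
    using that assms by blast
  obtain v where v: "v \<in> supported J"
      "\<forall>(a, b)\<in>A \<times> B. ip a b * ip v v \<noteq> 2 * ip a v * ip v b"
    using exists_reflection_vector[OF fin mem] by blast
  show thesis
  proof (rule that[of "\<lambda>y. y - fscale (2 * ip y v / ip v v) v"])
    show "y - fscale (2 * ip y v / ip v v) v \<in> supported J" if "y \<in> supported J" for y
      using that v(1) by (intro fs.subspace_diff fs.subspace_scale subspace_supported)
    show "ip (y - fscale (2 * ip y v / ip v v) v) (z - fscale (2 * ip z v / ip v v) v) = ip y z" for y z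
      by (rule reflection(1)[OF v(1)])
    show "ip a (b - fscale (2 * ip b v / ip v v) v) \<noteq> 0" if "a \<in> A" "b \<in> B" for a b
    proof -
      have *: "ip a b * ip v v \<noteq> 2 * ip a v * ip v b" using v(2) that by blast
      \<comment> \<open>Otherwise \<open>v\<close> is zero and both sides of the inequality
        vanish.\<close>
      then have "ip v v \<noteq> 0" using eq_0[OF v(1)] by auto
      with * reflection(2)[OF v(1)] show ?thesis by blast
    qed
  qed
qed

end

section \<open>Operations on representations\<close>

lemma represents_mono:
  fixes x :: "'a \<Rightarrow> 'i \<Rightarrow> 'f::rc_field"
  assumes "represents I x G" "I \<subseteq> J" "finite J"
  shows "represents J x G"
proof -
  have "sip J (x u) (x v) = sip I (x u) (x v)" if "u \<in> pverts G" for u v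
    unfolding sip_def using assms that
    by (intro sum.mono_neutral_right) (auto simp: represents_def supported_def)
  then show ?thesis
    using assms by (auto simp: represents_def dest!: subsetD[OF supported_mono[OF assms(2)]])
qed

text \<open>The map embeds \<open>G\<close> as an induced subgraph of \<open>K\<close>. This serves
  to find both graphs inside their join and inside the glued graph.\<close>

lemma represents_comp:
  assumes "represents I x K" "inj_on \<phi> (pverts G)" "\<phi> ` pverts G \<subseteq> pverts K"
    and "\<And>u v. u \<in> pverts G \<Longrightarrow> v \<in> pverts G \<Longrightarrow> u \<noteq> v \<Longrightarrow> (u, v) \<in> parcs G \<longleftrightarrow> (\<phi> u, \<phi> v) \<in> parcs K"
  shows "represents I (x \<circ> \<phi>) G"
  unfolding represents_def
proof (intro conjI ballI impI)
  show "finite I" "(x \<circ> \<phi>) ` pverts G \<subseteq> supported I"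
    using assms(1,3) by (auto simp: represents_def)
  fix u v assume uv: "u \<in> pverts G" "v \<in> pverts G" "u \<noteq> v"
  then have "\<phi> u \<noteq> \<phi> v" "\<phi> u \<in> pverts K" "\<phi> v \<in> pverts K"
    using assms(2,3) by (auto dest: inj_onD)
  then show "(u, v) \<in> parcs G \<longleftrightarrow> sip I ((x \<circ> \<phi>) u) ((x \<circ> \<phi>) v) \<noteq> 0"
    using assms(1,4) uv by (simp add: represents_def)
qed

lemma represents_nonzero:
  fixes x :: "'a \<Rightarrow> 'i \<Rightarrow> 'f::rc_field"
  assumes "represents I x G" "pair_graph G" "(u, v) \<in> parcs G"
  shows "x u \<noteq> 0" "x v \<noteq> 0"
proof -
  interpret pair_graph G by (rule assms)
  interpret s: pos_form I "sip I :: ('i \<Rightarrow> 'f) \<Rightarrow> _"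
    using assms(1) by (intro pos_form_sip) (simp add: represents_def)
  have "sip I (x u) (x v) \<noteq> 0"
    using assms(1,3) in_arcsD1[OF assms(3)] in_arcsD2[OF assms(3)] no_loops'[OF assms(3)]
    by (simp add: represents_def)
  then show "x u \<noteq> 0" "x v \<noteq> 0" by auto
qed

lemma dim_pos_finite:
  fixes S :: "('i \<Rightarrow> 'f::field) set"
  assumes "finite S" "y \<in> S" "y \<noteq> 0"
  shows "1 \<le> fs.dim S"
  using independent_card_le_dim_finite(2)[OF assms(1), of "{y}"] assms fs.span_base[of y S] by simp

text \<open>The minimality assumption speaks of positive dimensions only; an arc supplies a nonzero
  vector and hence dimension at least 1.\<close>

lemma represents_dim_ge:
  fixes x :: "'a \<Rightarrow> 'i \<Rightarrow> 'f::rc_field"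
  assumes min: "\<And>d. d \<ge> 1 \<Longrightarrow> is_frame_graph TYPE('f) d G \<Longrightarrow> k \<le> d"
    and rep: "represents I x G" and G: "pair_graph G" "parcs G \<noteq> {}"
  shows "k \<le> fs.dim (x ` pverts G)" "1 \<le> fs.dim (x ` pverts G)"
proof -
  interpret pair_graph G by (rule G)
  obtain u v where uv: "(u, v) \<in> parcs G" using G(2) by auto
  show "1 \<le> fs.dim (x ` pverts G)"
    using represents_nonzero(1)[OF rep G(1) uv] in_arcsD1[OF uv] pair_finite_verts
    by (intro dim_pos_finite[of _ "x u"]) auto
  then show "k \<le> fs.dim (x ` pverts G)"
    using min represents_is_frame_graph[OF rep] pair_digraph by blast
qed

text \<open>Replacing \<open>x u\<close> by its projection onto the span of the other vectors does not change the graph.\<close>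

lemma represents_dim_ge_remove:
  fixes x :: "'a \<Rightarrow> 'i \<Rightarrow> 'f::rc_field"
  assumes min: "\<And>d. d \<ge> 1 \<Longrightarrow> is_frame_graph TYPE('f) d G \<Longrightarrow> k \<le> d"
    and rep: "represents I x G" and G: "pair_graph G" "parcs G \<noteq> {}" and u: "u \<in> pverts G"
  shows "k \<le> fs.dim (x ` (pverts G - {u}))"
proof -
  interpret pair_graph G by (rule G)
  interpret s: pos_form I "sip I :: ('i \<Rightarrow> 'f) \<Rightarrow> _"
    using rep by (intro pos_form_sip) (simp add: represents_def)
  let ?S = "x ` (pverts G - {u})"
  have S: "finite ?S" "?S \<subseteq> supported I" using pair_finite_verts rep by (auto simp: represents_def)
  obtain p where p: "p \<in> fs.span ?S" "\<forall>s\<in>fs.span ?S. sip I (x u - p) s = 0"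
    using s.projection[OF S] by blast
  have proj: "sip I p (x v) = sip I (x u) (x v)" "sip I (x v) p = sip I (x v) (x u)"
    if "v \<in> pverts G" "v \<noteq> u" for v
  proof -
    have "x v \<in> fs.span ?S" using that by (intro fs.span_base) blast
    then have "sip I (x u - p) (x v) = 0" using p(2) by blast
    then show "sip I p (x v) = sip I (x u) (x v)" by (simp add: s.diff_left)
    then show "sip I (x v) p = sip I (x v) (x u)" using s.conj by metis
  qed
  have psupp: "p \<in> supported I" using p(1) fs.span_minimal[OF S(2) subspace_supported] by blast
  have "represents I (x(u := p)) G"
    unfolding represents_def
  proof (intro conjI ballI impI)
    show "finite I" "x(u := p) ` pverts G \<subseteq> supported I"
      using rep psupp by (auto simp: represents_def)
    fix a b assume ab: "a \<in> pverts G" "b \<in> pverts G" "a \<noteq> b"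
    then have "(a, b) \<in> parcs G \<longleftrightarrow> sip I (x a) (x b) \<noteq> 0"
      using rep by (simp add: represents_def)
    then show "(a, b) \<in> parcs G \<longleftrightarrow> sip I ((x(u := p)) a) ((x(u := p)) b) \<noteq> 0"
      using ab proj by auto
  qed
  then have "k \<le> fs.dim ((x(u := p)) ` pverts G)"
    using represents_dim_ge(1)[OF min] G by blast
  also have "(x(u := p)) ` pverts G = insert p ?S"
    using u by auto
  also have "fs.dim (insert p ?S) = fs.dim ?S"
    using p(1) by (intro fs.span_eq_dim fs.span_redundant)
  finally show ?thesis .
qed

subsection \<open>Minimal dimensions\<close>

lemma is_frame_graph_le_card:
  assumes "is_frame_graph TYPE('f::rc_field) d G" "finite (pverts G)"
  shows "d \<le> card (pverts G)"
proof -
  obtain x :: "'a \<Rightarrow> nat \<Rightarrow> 'f" where "fs.dim (x ` pverts G) = d"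
    using is_frame_graph_represents[OF assms(1)] by metis
  moreover have "fs.dim (x ` pverts G) \<le> card (x ` pverts G)"
    using assms(2) by (intro fs.dim_le_card fs.span_superset) simp
  ultimately show ?thesis using card_image_le[OF assms(2), of x] by linarith
qed

text \<open>Otherwise \<open>x\<close> would be injective on \<open>V\<close> with independent
  image, and the dimension would be \<open>card V\<close>. Repeated vectors count as
  redundant.\<close>

lemma obtain_redundant:
  fixes x :: "'a \<Rightarrow> 'i \<Rightarrow> 'f::field"
  assumes "finite V" "fs.dim (x ` V) < card V"
  obtains k where "k \<in> V" "x k \<in> fs.span (x ` (V - {k}))"
proof -
  have "\<exists>k\<in>V. x k \<in> fs.span (x ` (V - {k}))"
  proof (rule ccontr)
    assume "\<not> (\<exists>k\<in>V. x k \<in> fs.span (x ` (V - {k})))"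
    then have *: "x k \<notin> fs.span (x ` (V - {k}))" if "k \<in> V" for k using that by blast
    have "inj_on x V"
    proof (rule inj_onI, rule ccontr)
      fix u v assume uv: "u \<in> V" "v \<in> V" "x u = x v" "u \<noteq> v"
      then have "x u \<in> x ` (V - {u})" by (intro image_eqI[of _ _ v]) auto
      then have "x u \<in> fs.span (x ` (V - {u}))" by (rule fs.span_base)
      then show False using *[OF uv(1)] by simp
    qed
    moreover have "fs.independent (x ` V)"
    proof
      assume "fs.dependent (x ` V)"
      then obtain k where k: "k \<in> V" "x k \<in> fs.span (x ` V - {x k})"
        unfolding fs.dependent_def by blast
      have "fs.span (x ` V - {x k}) \<subseteq> fs.span (x ` (V - {k}))"
        by (rule fs.span_mono) blast
      then show False using k *[OF k(1)] by blast
    qed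
    ultimately have "fs.dim (x ` V) = card V"
      by (simp add: fs.dim_eq_card_independent card_image)
    then show False using assms(2) by simp
  qed
  then show thesis using that by blast
qed

lemma is_frame_graph_Suc:
  assumes frame: "is_frame_graph TYPE('f::rc_field) d G" and G: "pair_digraph G" and d: "d < card (pverts G)"
  shows "is_frame_graph TYPE('f) (Suc d) G"
proof -
  interpret pair_digraph G by (rule G)
  obtain x :: "'a \<Rightarrow> nat \<Rightarrow> 'f" where x: "represents {..<d} x G" "fs.dim (x ` pverts G) = d"
    by (rule is_frame_graph_represents[OF frame])
  obtain k where k: "k \<in> pverts G" "x k \<in> fs.span (x ` (pverts G - {k}))"
    using obtain_redundant[OF pair_finite_verts, of x] x(2) d by auto
  let ?S = "x ` (pverts G - {k})"
  \<comment> \<open>The new coordinate \<open>d\<close> is nonzero for \<open>k\<close> alone, so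
    inner products of distinct vertices do not change, while \<open>y k\<close> leaves the span of
    the others.\<close>
  define y where "y = x(k := x k + unit_fun d)"
  have xd: "x v l = 0" if "v \<in> pverts G" "l \<ge> d" for v l
    using x(1) that by (auto simp: represents_def supported_def)
  have "represents {..<Suc d} y G"
    unfolding represents_def
  proof (intro conjI ballI impI)
    show "y ` pverts G \<subseteq> supported {..<Suc d}"
      using xd by (auto simp: y_def supported_def fun_apply unit_fun_def)
    fix u v assume uv: "u \<in> pverts G" "v \<in> pverts G" "u \<noteq> v"
    have low: "y w l = x w l" if "l < d" for w l
      using that by (simp add: y_def fun_apply unit_fun_def)
    have "y u d = 0 \<or> y v d = 0" using uv xd by (auto simp: y_def)
    then have "sip {..<Suc d} (y u) (y v) = sip {..<d} (x u) (x v)"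
      by (auto simp: sip_def low)
    then show "(u, v) \<in> parcs G \<longleftrightarrow> sip {..<Suc d} (y u) (y v) \<noteq> 0"
      using x(1) uv by (simp add: represents_def)
  qed simp
  then have "is_frame_graph TYPE('f) (fs.dim (y ` pverts G)) G"
    by (rule represents_is_frame_graph[OF _ G])
  moreover have "fs.dim (y ` pverts G) = Suc d"
  proof -
    have "y ` pverts G = insert (y k) ?S"
      using k(1) by (auto simp: y_def)
    moreover have "y k \<notin> fs.span ?S"
    proof
      have "?S \<subseteq> supported {..<d}" using x(1) by (auto simp: represents_def)
      then have "fs.span ?S \<subseteq> supported {..<d}" by (rule fs.span_minimal[OF _ subspace_supported])
      moreover assume "y k \<in> fs.span ?S"
      ultimately have "y k d = 0" by (auto simp: supported_def)
      then show False using xd[OF k(1)] by (simp add: y_def fun_apply unit_fun_def)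
    qed
    moreover have "fs.dim ?S = d"
    proof -
      have "x ` pverts G = insert (x k) ?S" using k(1) by auto
      then have "fs.dim (x ` pverts G) = fs.dim ?S"
        using fs.span_eq_dim[OF fs.span_redundant[OF k(2)]] by simp
      then show ?thesis using x(2) by simp
    qed
    ultimately show ?thesis
      using pair_finite_verts by (simp add: dim_insert_finite)
  qed
  ultimately show ?thesis by simp
qed

text \<open>From the minimal dimension on, dimensions are gained one by one up to the number of
  vertices; beyond it there are too few vectors to span.\<close>

lemma is_frame_graph_iff_interval:
  assumes G: "pair_digraph G" and a: "is_frame_graph TYPE('f::rc_field) a G"
    and min: "\<And>d. d \<ge> 1 \<Longrightarrow> is_frame_graph TYPE('f) d G \<Longrightarrow> a \<le> d" and "d \<ge> 1"
  shows "is_frame_graph TYPE('f) d G \<longleftrightarrow> a \<le> d \<and> d \<le> card (pverts G)"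
proof
  assume "is_frame_graph TYPE('f) d G"
  then show "a \<le> d \<and> d \<le> card (pverts G)"
    using min[OF \<open>d \<ge> 1\<close>] is_frame_graph_le_card pair_fin_digraph.pair_finite_verts pair_digraph.axioms(1)[OF G]
    by blast
next
  assume d: "a \<le> d \<and> d \<le> card (pverts G)"
  then have "a \<le> d" by simp
  then have "d \<le> card (pverts G) \<longrightarrow> is_frame_graph TYPE('f) d G"
    by (induction d rule: dec_induct) (use a is_frame_graph_Suc[OF _ G, where 'f='f] in auto)
  then show "is_frame_graph TYPE('f) d G" using d by simp
qed

text \<open>The vectors are the rows of the vertex-edge incidence matrix.\<close>

lemma exists_frame_graph:
  assumes G: "pair_graph G" "parcs G \<noteq> {}"
  shows "\<exists>d\<ge>1. is_frame_graph TYPE('f::rc_field) d G"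
proof -
  interpret pair_graph G by (rule G)
  define x :: "'a \<Rightarrow> 'a \<times> 'a \<Rightarrow> 'f" where
    "x v e = (if e \<in> parcs G \<and> (fst e = v \<or> snd e = v) then 1 else 0)" for v e
  have "represents (parcs G) x G"
    unfolding represents_def
  proof (intro conjI ballI impI)
    show "x ` pverts G \<subseteq> supported (parcs G)" by (auto simp: x_def supported_def)
    fix u v assume uv: "u \<in> pverts G" "v \<in> pverts G" "u \<noteq> v"
    \<comment> \<open>The arcs incident to both vertices. Their number is the inner product, and it
      is nonzero in the field because the characteristic is 0.\<close>
    let ?E = "{e \<in> parcs G. (fst e = u \<or> snd e = u) \<and> (fst e = v \<or> snd e = v)}"
    have "sip (parcs G) (x u) (x v) = (\<Sum>e\<in>parcs G. if e \<in> ?E then 1 else 0)"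
      unfolding sip_def by (intro sum.cong refl) (auto simp: x_def)
    also have "\<dots> = of_nat (card ?E)"
      using pair_finite_arcs by (simp add: sum.If_cases Int_def conj_ac)
    finally have "sip (parcs G) (x u) (x v) \<noteq> 0 \<longleftrightarrow> ?E \<noteq> {}"
      using pair_finite_arcs by simp
    also have "\<dots> \<longleftrightarrow> (u, v) \<in> parcs G"
      using uv(3) arcs_symmetric[of v u] by fastforce
    finally show "(u, v) \<in> parcs G \<longleftrightarrow> sip (parcs G) (x u) (x v) \<noteq> 0" by simp
  qed (rule pair_finite_arcs)
  then show ?thesis
    using represents_is_frame_graph[OF _ pair_digraph] represents_dim_ge(2)[OF _ _ G, of 0] by blast
qed

text \<open>Connectedness gives a path in the symmetric closure from \<open>u\<close> to another
  vertex, and its first step is an arc. Hence there are no isolated vertices, and all representing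
  vectors are nonzero.\<close>

lemma connected_imp_arc:
  assumes "pair_graph G" "Digraph_Component.connected (with_proj G)" "card (pverts G) > 1" "u \<in> pverts G"
  obtains v where "(u, v) \<in> parcs G"
proof -
  interpret pair_graph G by (rule assms)
  have "\<not> pverts G \<subseteq> {u}" using assms(3) card_mono[of "{u}" "pverts G"] by auto
  then obtain w where w: "w \<in> pverts G" "w \<noteq> u" by blast
  let ?M = "mk_symmetric (with_proj G)"
  have "u \<rightarrow>\<^sup>*\<^bsub>with_proj ?M\<^esub> w"
    using assms(2,4) w unfolding connected_def strongly_connected_def by simp
  then have "(u, w) \<in> rtrancl_on (pverts G) (parcs ?M)"
    by (simp add: reachable_def)
  then obtain c where "(u, c) \<in> parcs ?M"
    using w(2) by (cases rule: converse_rtrancl_on_cases) auto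
  then have "(u, c) \<in> parcs G" using arcs_symmetric by (auto simp: parcs_mk_symmetric)
  then show thesis by (rule that)
qed

text \<open>The interval from \<open>k\<close> to \<open>n\<close> could be empty a priori. Since
  the graph is a frame graph in some positive dimension, \<open>k \<le> n\<close>, and
  \<open>k\<close> itself is attained.\<close>

lemma just_frame_graph_minimal:
  assumes "pair_graph G" "parcs G \<noteq> {}" "k \<ge> 1"
    and "\<And>d. d \<ge> 1 \<Longrightarrow> is_frame_graph TYPE('f::rc_field) d G \<longleftrightarrow> k \<le> d \<and> d \<le> n"
  shows "is_frame_graph TYPE('f) k G"
  using exists_frame_graph[OF assms(1,2), where 'f='f] assms(3,4) by fastforce

section \<open>The join\<close>

lemma pair_digraph_graph_join:
  assumes "pair_graph G" "pair_graph H"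
  shows "pair_digraph (graph_join G H)"
proof -
  interpret G: pair_graph G by (rule assms)
  interpret H: pair_graph H by (rule assms)
  show ?thesis
    by unfold_locales
      (auto simp: graph_join_def G.pair_finite_verts G.pair_finite_arcs H.pair_finite_verts H.pair_finite_arcs
        dest: G.wellformed' H.wellformed' G.no_loops' H.no_loops')
qed

lemma arcs_graph_join:
  "(Inl a, Inl b) \<in> parcs (graph_join G H) \<longleftrightarrow> (a, b) \<in> parcs G"
  "(Inr c, Inr d) \<in> parcs (graph_join G H) \<longleftrightarrow> (c, d) \<in> parcs H"
  "(Inl a, Inr d) \<in> parcs (graph_join G H) \<longleftrightarrow> a \<in> pverts G \<and> d \<in> pverts H"
  "(Inr c, Inl b) \<in> parcs (graph_join G H) \<longleftrightarrow> c \<in> pverts H \<and> b \<in> pverts G"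
  by (auto simp: graph_join_def)

lemma frame_graph_join:
  fixes G :: "'a pair_pre_digraph" and H :: "'b pair_pre_digraph"
  assumes G: "pair_graph G" "\<And>u. u \<in> pverts G \<Longrightarrow> \<exists>v. (u, v) \<in> parcs G" "parcs G \<noteq> {}"
    and H: "pair_graph H" "\<And>u. u \<in> pverts H \<Longrightarrow> \<exists>v. (u, v) \<in> parcs H"
    and "is_frame_graph TYPE('f::rc_field) k G" "is_frame_graph TYPE('f) l H" "l \<le> k"
    and min: "\<And>d. d \<ge> 1 \<Longrightarrow> is_frame_graph TYPE('f) d G \<Longrightarrow> k \<le> d" and "d \<ge> 1"
  shows "is_frame_graph TYPE('f) d (graph_join G H) \<longleftrightarrow> k \<le> d \<and> d \<le> card (pverts G) + card (pverts H)"
proof -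
  let ?K = "graph_join G H"
  interpret G: pair_graph G by (rule G)
  interpret H: pair_graph H by (rule H)
  have K: "pair_digraph ?K" by (rule pair_digraph_graph_join[OF G(1) H(1)])
  have vK: "pverts ?K = Inl ` pverts G \<union> Inr ` pverts H" by (simp add: graph_join_def)
  have card_K: "card (pverts ?K) = card (pverts G) + card (pverts H)"
    unfolding vK using G.pair_finite_verts H.pair_finite_verts
    by (subst card_Un_disjoint) (auto simp: card_image)
  have low: "k \<le> fs.dim (z ` pverts ?K)" if "represents I z ?K" for I and z :: "'a + 'b \<Rightarrow> nat \<Rightarrow> 'f"
  proof -
    have "represents I (z \<circ> Inl) G"
      by (rule represents_comp[OF that]) (auto simp: vK arcs_graph_join)
    then have "k \<le> fs.dim ((z \<circ> Inl) ` pverts G)"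
      using represents_dim_ge(1)[OF min] G by blast
    also have "\<dots> \<le> fs.dim (z ` pverts ?K)"
    proof (rule dim_mono_finite)
      show "finite (z ` pverts ?K)" using G.pair_finite_verts H.pair_finite_verts by (simp add: vK)
      have "(z \<circ> Inl) ` pverts G \<subseteq> z ` pverts ?K" by (auto simp: vK)
      then show "(z \<circ> Inl) ` pverts G \<subseteq> fs.span (z ` pverts ?K)"
        using fs.span_superset order_trans by metis
    qed
    finally show ?thesis .
  qed
  obtain x :: "'a \<Rightarrow> nat \<Rightarrow> 'f" where x: "represents {..<k} x G"
    by (rule is_frame_graph_represents[OF assms(6)])
  obtain y0 :: "'b \<Rightarrow> nat \<Rightarrow> 'f" where "represents {..<l} y0 H"
    by (rule is_frame_graph_represents[OF assms(7)])
  \<comment> \<open>As \<open>l \<le> k\<close>, the vectors of \<open>H\<close> also live in the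
    space of the vectors of \<open>G\<close>.\<close>
  then have y: "represents {..<k} y0 H"
    by (rule represents_mono) (use \<open>l \<le> k\<close> in auto)
  interpret s: pos_form "{..<k}" "sip {..<k} :: (nat \<Rightarrow> 'f) \<Rightarrow> _" by (rule pos_form_sip) simp
  have A: "x ` pverts G \<subseteq> supported {..<k} - {0}"
    using x G(2) represents_nonzero(1)[OF x G(1)] by (auto simp: represents_def)
  have B: "y0 ` pverts H \<subseteq> supported {..<k} - {0}"
    using y H(2) represents_nonzero(1)[OF y H(1)] by (auto simp: represents_def)
  obtain U where U: "\<And>y. y \<in> supported {..<k} \<Longrightarrow> U y \<in> supported {..<k}"
    "\<And>y z. sip {..<k} (U y) (U z) = sip {..<k} y z"
    "\<And>a b. a \<in> x ` pverts G \<Longrightarrow> b \<in> y0 ` pverts H \<Longrightarrow> sip {..<k} a (U b) \<noteq> 0"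
    by (rule s.exists_isometry_nonorthogonal[OF _ _ A B]) (use G.pair_finite_verts H.pair_finite_verts in auto)
  \<comment> \<open>The isometry \<open>U\<close> preserves the graph of \<open>H\<close> and makes
    all mixed inner products nonzero.\<close>
  define z where "z = case_sum x (U \<circ> y0)"
  have supp: "z ` pverts ?K \<subseteq> supported {..<k}"
    using A B U(1) by (auto simp: vK z_def)
  have rep: "represents {..<k} z ?K"
    unfolding represents_def
  proof (intro conjI ballI impI supp)
    fix a b assume ab: "a \<in> pverts ?K" "b \<in> pverts ?K" "a \<noteq> b"
    have mixed: "sip {..<k} (x u) (U (y0 v)) \<noteq> 0" "sip {..<k} (U (y0 v)) (x u) \<noteq> 0"
      if "u \<in> pverts G" "v \<in> pverts H" for u v
      using U(3) that s.zero_commute by blast+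
    show "(a, b) \<in> parcs ?K \<longleftrightarrow> sip {..<k} (z a) (z b) \<noteq> 0"
      using ab x y mixed
      by (cases a; cases b) (auto simp: vK z_def arcs_graph_join U(2) represents_def)
  qed simp
  \<comment> \<open>The general lower bound, applied to this representation, shows that it spans the
    whole space.\<close>
  have "fs.dim (z ` pverts ?K) = k"
    using low[OF rep] dim_supported_le[OF _ supp] by simp
  then have K_min: "is_frame_graph TYPE('f) k ?K"
    using represents_is_frame_graph[OF rep K] by simp
  have K_low: "k \<le> d" if K_d: "is_frame_graph TYPE('f) d ?K" for d
  proof -
    obtain z :: "'a + 'b \<Rightarrow> nat \<Rightarrow> 'f" where "represents {..<d} z ?K" "fs.dim (z ` pverts ?K) = d"
      by (rule is_frame_graph_represents[OF K_d])
    then show ?thesis using low by blast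
  qed
  show ?thesis
    unfolding card_K[symmetric]
    by (rule is_frame_graph_iff_interval[OF K K_min _ \<open>d \<ge> 1\<close>]) (rule K_low)
qed

section \<open>Gluing at a vertex\<close>

text \<open>An arc of \<open>H\<close> could join two \<open>Inl\<close> vertices only as the image
  of a loop at \<open>w\<close>, and there are no loops.\<close>

lemma arcs_graph_glue:
  assumes "pair_graph G" "pair_graph H"
  shows "(Inl a, Inl b) \<in> parcs (graph_glue G u H w) \<longleftrightarrow> (a, b) \<in> parcs G"
    and "(Inr c, Inr d) \<in> parcs (graph_glue G u H w) \<longleftrightarrow> (c, d) \<in> parcs H \<and> c \<noteq> w \<and> d \<noteq> w"
    and "(Inl a, Inr d) \<in> parcs (graph_glue G u H w) \<longleftrightarrow> a = u \<and> (w, d) \<in> parcs H"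
    and "(Inr c, Inl b) \<in> parcs (graph_glue G u H w) \<longleftrightarrow> b = u \<and> (c, w) \<in> parcs H"
proof -
  interpret H: pair_graph H by (rule assms)
  have loop: "(v, v) \<notin> parcs H" for v using H.no_loops' by blast
  have image: "(p, q) \<in> map_prod g g ` R \<longleftrightarrow> (\<exists>a b. (a, b) \<in> R \<and> g a = p \<and> g b = q)" for g p q R
    by force
  show "(Inl a, Inl b) \<in> parcs (graph_glue G u H w) \<longleftrightarrow> (a, b) \<in> parcs G"
    and "(Inr c, Inr d) \<in> parcs (graph_glue G u H w) \<longleftrightarrow> (c, d) \<in> parcs H \<and> c \<noteq> w \<and> d \<noteq> w"
    and "(Inl a, Inr d) \<in> parcs (graph_glue G u H w) \<longleftrightarrow> a = u \<and> (w, d) \<in> parcs H"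
    and "(Inr c, Inl b) \<in> parcs (graph_glue G u H w) \<longleftrightarrow> b = u \<and> (c, w) \<in> parcs H"
    using loop unfolding graph_glue_def Let_def pair_pre_digraph.simps Un_iff image by (auto split: if_splits) metis+
qed

lemma verts_graph_glue:
  assumes "u \<in> pverts G" "w \<in> pverts H"
  shows "pverts (graph_glue G u H w) = Inl ` pverts G \<union> Inr ` (pverts H - {w})"
  using assms by (auto simp: graph_glue_def Let_def)

lemma pair_digraph_graph_glue:
  assumes "pair_graph G" "pair_graph H" "u \<in> pverts G" "w \<in> pverts H"
  shows "pair_digraph (graph_glue G u H w)"
proof -
  interpret G: pair_graph G by (rule assms)
  interpret H: pair_graph H by (rule assms)
  let ?K = "graph_glue G u H w"
  have arc: "a \<in> pverts ?K \<and> b \<in> pverts ?K \<and> a \<noteq> b" if "(a, b) \<in> parcs ?K" for a b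
    using that assms(3) G.wellformed' H.wellformed' G.no_loops' H.no_loops'
    by (cases a; cases b) (fastforce simp: arcs_graph_glue[OF assms(1,2)] verts_graph_glue[OF assms(3,4)])+
  show ?thesis
  proof
    show "finite (pverts ?K)" "finite (parcs ?K)"
      by (simp_all add: graph_glue_def Let_def G.pair_finite_verts G.pair_finite_arcs
        H.pair_finite_verts H.pair_finite_arcs)
  qed (use arc in auto)
qed

lemma sip_Plus:
  assumes "finite A" "finite B"
  shows "sip (A <+> B) (case_sum a b) (case_sum c d) = sip A a c + sip B b d"
  using assms by (simp add: sip_def sum.Plus)

lemma case_sum_supported:
  "case_sum a b \<in> supported (A <+> B) \<longleftrightarrow> a \<in> supported A \<and> b \<in> supported B"
  by (auto simp: supported_def split: sum.splits)

lemma frame_graph_glue: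
  fixes G :: "'a pair_pre_digraph" and H :: "'b pair_pre_digraph"
  assumes G: "pair_graph G" "parcs G \<noteq> {}" "u \<in> pverts G"
    and H: "pair_graph H" "parcs H \<noteq> {}" "w \<in> pverts H"
    and "is_frame_graph TYPE('f::rc_field) k G" "is_frame_graph TYPE('f) l H"
    and minG: "\<And>d. d \<ge> 1 \<Longrightarrow> is_frame_graph TYPE('f) d G \<Longrightarrow> k \<le> d"
    and minH: "\<And>d. d \<ge> 1 \<Longrightarrow> is_frame_graph TYPE('f) d H \<Longrightarrow> l \<le> d" and "d \<ge> 1"
  shows "is_frame_graph TYPE('f) d (graph_glue G u H w)
    \<longleftrightarrow> k + l \<le> d \<and> d \<le> card (pverts G) + card (pverts H) - 1"
proof -
  let ?K = "graph_glue G u H w"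
  interpret G: pair_graph G by (rule G)
  interpret H: pair_graph H by (rule H)
  have K: "pair_digraph ?K" by (rule pair_digraph_graph_glue[OF G(1) H(1) G(3) H(3)])
  note vK = verts_graph_glue[OF G(3) H(3)]
  note arcs_K = arcs_graph_glue[OF G(1) H(1)]
  have finK: "finite (pverts ?K)" using G.pair_finite_verts H.pair_finite_verts by (simp add: vK)
  have "card (pverts H) > 0" using H(3) H.pair_finite_verts card_gt_0_iff by blast
  then have card_K: "card (pverts ?K) = card (pverts G) + card (pverts H) - 1"
    unfolding vK using G.pair_finite_verts H.pair_finite_verts H(3)
    by (subst card_Un_disjoint) (auto simp: card_image card_Diff_singleton)
  \<comment> \<open>The index type is left general, since the bound is applied to representations
    indexed by \<open>nat\<close> and to one indexed by \<open>nat + nat\<close>.\<close>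
  have low: "k + l \<le> fs.dim (z ` pverts ?K)" if rep: "represents I z ?K"
    for I and z :: "'a + 'b \<Rightarrow> 'i \<Rightarrow> 'f"
  proof -
    interpret s: pos_form I "sip I :: ('i \<Rightarrow> 'f) \<Rightarrow> _"
      using rep by (intro pos_form_sip) (simp add: represents_def)
    let ?g = "\<lambda>y. if y = w then Inl u else Inr y"
    \<comment> \<open>The common vertex is left out on both sides: no arcs join the remaining
      vertices of \<open>G\<close> to those of \<open>H\<close>, so these families are orthogonal,
      and removing one vertex does not push the dimension below the minimum.\<close>
    let ?S = "(z \<circ> Inl) ` (pverts G - {u})" and ?T = "(z \<circ> ?g) ` (pverts H - {w})"
    have "represents I (z \<circ> Inl) G"
      by (rule represents_comp[OF rep]) (auto simp: vK arcs_K)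
    then have kS: "k \<le> fs.dim ?S"
      by (rule represents_dim_ge_remove[OF _ _ G, rotated]) (rule minG)
    have "represents I (z \<circ> ?g) H"
      by (rule represents_comp[OF rep]) (use G(3) in \<open>auto simp: vK arcs_K inj_on_def\<close>)
    then have lT: "l \<le> fs.dim ?T"
      by (rule represents_dim_ge_remove[OF _ _ H, rotated]) (rule minH)
    have ST: "?S \<subseteq> z ` pverts ?K" "?T \<subseteq> z ` pverts ?K" by (auto simp: vK)
    have fin: "finite ?S" "finite ?T" "finite (z ` pverts ?K)"
      using G.pair_finite_verts H.pair_finite_verts finK by simp_all
    have "sip I s t = 0" if st: "s \<in> ?S" "t \<in> ?T" for s t
    proof -
      obtain a b where ab: "a \<in> pverts G" "a \<noteq> u" "s = z (Inl a)" "b \<in> pverts H" "b \<noteq> w" "t = z (Inr b)"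
        using st by auto
      then have "Inl a \<in> pverts ?K" "Inr b \<in> pverts ?K" "(Inl a, Inr b) \<notin> parcs ?K"
        by (simp_all add: vK arcs_K)
      then show ?thesis using rep ab by (auto simp: represents_def)
    qed
    moreover have "?S \<subseteq> supported I" using rep order_trans[OF ST(1)] by (simp add: represents_def)
    ultimately have "fs.span ?S \<inter> fs.span ?T \<subseteq> {0}"
      by (rule s.orthogonal_spans_trivial_Int)
    then have "fs.dim ?S + fs.dim ?T \<le> fs.dim (z ` pverts ?K)"
      using ST by (intro dim_trivial_Int fin order_trans[OF _ fs.span_superset])
    then show ?thesis using kS lT by linarith
  qed
  obtain x :: "'a \<Rightarrow> nat \<Rightarrow> 'f" where x: "represents {..<k} x G"
    by (rule is_frame_graph_represents[OF assms(7)])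
  obtain y :: "'b \<Rightarrow> nat \<Rightarrow> 'f" where y: "represents {..<l} y H"
    by (rule is_frame_graph_represents[OF assms(8)])
  interpret sx: pos_form "{..<k}" "sip {..<k} :: (nat \<Rightarrow> 'f) \<Rightarrow> _" by (rule pos_form_sip) simp
  interpret sy: pos_form "{..<l}" "sip {..<l} :: (nat \<Rightarrow> 'f) \<Rightarrow> _" by (rule pos_form_sip) simp
  let ?I = "{..<k} <+> {..<l}"
  \<comment> \<open>The orthogonal sum of both representations; only the common vertex
    \<open>Inl u\<close> has components \<open>x u\<close> and \<open>y w\<close> in both
    summands.\<close>
  define z :: "'a + 'b \<Rightarrow> nat + nat \<Rightarrow> 'f" where
    "z = case_sum (\<lambda>a. case_sum (x a) (if a = u then y w else 0)) (\<lambda>b. case_sum 0 (y b))"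
  have xy_supp: "x a \<in> supported {..<k}" "y b \<in> supported {..<l}"
    if "a \<in> pverts G" "b \<in> pverts H" for a b
    using x y that unfolding represents_def by blast+
  have supp: "z ` pverts ?K \<subseteq> supported ?I"
    using xy_supp G(3) H(3)
    by (auto simp: vK z_def case_sum_supported fs.subspace_0[OF subspace_supported])
  have rep: "represents ?I z ?K"
    unfolding represents_def
  proof (intro conjI ballI impI supp)
    fix a b assume ab: "a \<in> pverts ?K" "b \<in> pverts ?K" "a \<noteq> b"
    show "(a, b) \<in> parcs ?K \<longleftrightarrow> sip ?I (z a) (z b) \<noteq> 0"
      using ab x y H(3)
      by (cases a; cases b) (auto simp: vK z_def arcs_K sip_Plus represents_def)
  qed simp
  have "fs.dim (z ` pverts ?K) \<le> card ?I"
    by (rule dim_supported_le[OF _ supp]) simp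
  then have "fs.dim (z ` pverts ?K) = k + l"
    using low[OF rep] by (simp add: card_Plus)
  then have K_min: "is_frame_graph TYPE('f) (k + l) ?K"
    using represents_is_frame_graph[OF rep K] by simp
  have K_low: "k + l \<le> d" if K_d: "is_frame_graph TYPE('f) d ?K" for d
  proof -
    obtain z :: "'a + 'b \<Rightarrow> nat \<Rightarrow> 'f" where "represents {..<d} z ?K" "fs.dim (z ` pverts ?K) = d"
      by (rule is_frame_graph_represents[OF K_d])
    then show ?thesis using low by blast
  qed
  show ?thesis
    unfolding card_K[symmetric]
    by (rule is_frame_graph_iff_interval[OF K K_min _ \<open>d \<ge> 1\<close>]) (rule K_low)
qed

section \<open>Both constructions over one scalar field, then over the reals and the complex
  numbers\<close>

lemma frame_graph_join_glue:
  fixes G :: "'a pair_pre_digraph" and H :: "'b pair_pre_digraph"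
  assumes G: "pair_graph G" "Digraph_Component.connected (with_proj G)" "card (pverts G) > 1"
    and H: "pair_graph H" "Digraph_Component.connected (with_proj H)" "card (pverts H) > 1"
    and k: "k \<ge> 1" and l: "l \<ge> 1" and le: "l \<le> k"
    and fG: "\<forall>d\<ge>1. is_frame_graph TYPE('f::rc_field) d G \<longleftrightarrow> k \<le> d \<and> d \<le> n"
    and fH: "\<forall>d\<ge>1. is_frame_graph TYPE('f) d H \<longleftrightarrow> l \<le> d \<and> d \<le> m"
    and "d \<ge> 1"
  shows "is_frame_graph TYPE('f) d (graph_join G H)
      \<longleftrightarrow> k \<le> d \<and> d \<le> card (pverts G) + card (pverts H)"
    and "u \<in> pverts G \<Longrightarrow> w \<in> pverts H \<Longrightarrow> is_frame_graph TYPE('f) d (graph_glue G u H w)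
      \<longleftrightarrow> k + l \<le> d \<and> d \<le> card (pverts G) + card (pverts H) - 1"
proof -
  have arcG: "\<exists>v. (u, v) \<in> parcs G" if "u \<in> pverts G" for u
    using connected_imp_arc[OF G that] by blast
  have arcH: "\<exists>v. (u, v) \<in> parcs H" if "u \<in> pverts H" for u
    using connected_imp_arc[OF H that] by blast
  have "pverts G \<noteq> {}" "pverts H \<noteq> {}" using G(3) H(3) by auto
  then have ne: "parcs G \<noteq> {}" "parcs H \<noteq> {}" using arcG arcH by blast+
  have minG: "is_frame_graph TYPE('f) k G"
    by (rule just_frame_graph_minimal[OF G(1) ne(1) k]) (use fG in blast)
  have minH: "is_frame_graph TYPE('f) l H"
    by (rule just_frame_graph_minimal[OF H(1) ne(2) l]) (use fH in blast)
  show "is_frame_graph TYPE('f) d (graph_join G H)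
      \<longleftrightarrow> k \<le> d \<and> d \<le> card (pverts G) + card (pverts H)"
    by (rule frame_graph_join[OF G(1) arcG ne(1) H(1) arcH minG minH le _ \<open>d \<ge> 1\<close>]) (use fG in blast)+
  show "is_frame_graph TYPE('f) d (graph_glue G u H w)
      \<longleftrightarrow> k + l \<le> d \<and> d \<le> card (pverts G) + card (pverts H) - 1"
    if "u \<in> pverts G" "w \<in> pverts H"
    by (rule frame_graph_glue[OF G(1) ne(1) that(1) H(1) ne(2) that(2) minG minH _ _ \<open>d \<ge> 1\<close>])
      (use fG fH in blast)+
qed

theorem theorem3p4:
  fixes G :: "'a pair_pre_digraph" and H :: "'b pair_pre_digraph"
    and n m n' m' :: nat
  assumes "pair_graph G" and "pair_graph H"
    and "Digraph_Component.connected (with_proj G)" and "Digraph_Component.connected (with_proj H)"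
    and "card (pverts G) = n" and "card (pverts H) = m"
    and "n > 1" and "m > 1"
    and "n' \<ge> 1" and "m' \<ge> 1"
    and "just_frame_graph G n' n" and "just_frame_graph H m' m"
    and "n' \<ge> m'"
  shows "just_frame_graph (graph_join G H) n' (m + n)
    \<and> (\<forall>u \<in> pverts G. \<forall>w \<in> pverts H.
        just_frame_graph (graph_glue G u H w) (n' + m') (m + n - 1))"
proof -
  have card: "card (pverts G) > 1" "card (pverts H) > 1" "card (pverts G) + card (pverts H) = m + n"
    using assms(5-8) by simp_all
  note field = frame_graph_join_glue[OF assms(1,3) card(1) assms(2,4) card(2) assms(9,10,13), unfolded card(3)]
  have real: "\<forall>d\<ge>1. is_frame_graph TYPE(real) d G \<longleftrightarrow> n' \<le> d \<and> d \<le> n"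
      "\<forall>d\<ge>1. is_frame_graph TYPE(real) d H \<longleftrightarrow> m' \<le> d \<and> d \<le> m"
    and complex: "\<forall>d\<ge>1. is_frame_graph TYPE(complex) d G \<longleftrightarrow> n' \<le> d \<and> d \<le> n"
      "\<forall>d\<ge>1. is_frame_graph TYPE(complex) d H \<longleftrightarrow> m' \<le> d \<and> d \<le> m"
    using assms(11,12) by (simp_all add: just_frame_graph_def)
  show ?thesis
    unfolding just_frame_graph_def using field[OF real] field[OF complex] by simp
qed

end
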